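(* Let $\mathcal{P}$ be a strongly monotone property of ordered hypergraphs. Suppose that for every constant $c > 0$ there exists $N = N(c) \in \mathbb{N}$ such that $|\mathcal{P}_N| > c^N$. Then $\mathcal{P}$ contains the ordered hypergraph $H(\pi)$ for every $k \in \mathbb{N}$ and every permutation $\pi$ of $[k]$, and hence $$|\mathcal{P}_n| \ge |\mathcal{P}^{(1,2)}_n| \ge \sum_{k=0}^{\lfloor n/2 \rfloor} \binom{n}{2k} k! = n^{n/2 + o(n)}$$ for every $n \in \mathbb{N}$. This lower bound is best possible, and there is a unique strongly monotone property of ordered hypergraphs with this speed, i.e. there is exactly one strongly monotone property $\mathcal{Q}$ of ordered hypergraphs with $|\mathcal{Q}_n| = \sum_{k=0}^{\lfloor n/2 \rfloor} \binom{n}{2k} k!$ for every $n \in \mathbb{N}$.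
   Context: An ordered hypergraph $\mathcal{H} = (V,E,<)$ consists of a finite set $V$ of vertices, a set $E \subset \{A : A \subset V, |A| \ge 2\}$ of edges (no repeated edges, no edges with fewer than two vertices), and a linear order $<$ on $V$. An ordered hypergraph $\mathcal{K} = (U,F,<)$ is a sub-hypergraph of $\mathcal{H} = (V,E,<)$ if $U \subset V$ (with the induced ordering) and $F \subset \{e \cap U : e \in E, |e \cap U| \ge 2\}$. An ordered hypergraph $\mathcal{K} = (U,F,<)$ is contained in $\mathcal{H}$ if there exists a sub-hypergraph $\mathcal{L} = (U,D,<)$ of $\mathcal{H}$ with $|D| = |F| = t$, say, and enumerations $D = \{d_1,\ldots,d_t\}$, $F = \{f_1,\ldots,f_t\}$ such that $f_i \subset d_i$ for each $i \in [t]$. A property of ordered hypergraphs is a collection of ordered hypergraphs closed under order-preserving isomorphisms of the vertex set. It is strongly monotone if it is closed under containment: whenever $\mathcal{H}$ is in it and $\mathcal{K}$ is contained in $\mathcal{H}$, then $\mathcal{K}$ is in it. $\mathcal{P}_n$ denotes the collection of distinct (i.e. non-isomorphic under order-preserving isomorphism) ordered hypergraphs on $n$ vertices in $\mathcal{P}$; the speed of $\mathcal{P}$ is the function $n \mapsto |\mathcal{P}_n|$. For $k,\ell \in \mathbb{N}\cup\{\infty\}$, $\mathcal{P}^{(k,\ell)}$ is the set of $G \in \mathcal{P}$ in which every vertex is contained in at most $k$ edges and every edge has size at most $\ell$. For a permutation $\pi$ of $[k] = \{1,\ldots,k\}$, $H(\pi)$ is the ordered hypergraph with vertex set $[2k]$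 (usual order) and edge set $\{\{i,\pi(i)+k\} : i \in [k]\}$. *)

theory Defs
  imports
    Complex_Main
    "HOL-Library.Extended_Nat"
    "HOL-Library.Landau_Symbols"
    "HOL-Combinatorics.Permutations"
begin

text \<open>
  The linear order is recorded as its reflexive relation on the vertex set (the relation
  \<open>\<le>\<close> belonging to \<open><\<close>).
\<close>

record 'a ordered_hypergraph =
  verts :: "'a set"
  edges :: "'a set set"
  ord :: "'a rel"

definition ordered_hypergraph :: "'a ordered_hypergraph \<Rightarrow> bool" where
  "ordered_hypergraph H \<longleftrightarrow>
     finite (verts H) \<and>
     (\<forall>e\<in>edges H. e \<subseteq> verts H \<and> 2 \<le> card e) \<and>
     linear_order_on (verts H) (ord H)"

definition sub_hypergraph :: "'a ordered_hypergraph \<Rightarrow> 'a ordered_hypergraph \<Rightarrow> bool" where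
  "sub_hypergraph K H \<longleftrightarrow>
     ordered_hypergraph K \<and> ordered_hypergraph H \<and>
     verts K \<subseteq> verts H \<and>
     ord K = Restr (ord H) (verts K) \<and>
     edges K \<subseteq> {e \<inter> verts K | e. e \<in> edges H \<and> 2 \<le> card (e \<inter> verts K)}"

definition contained_in :: "'a ordered_hypergraph \<Rightarrow> 'a ordered_hypergraph \<Rightarrow> bool" where
  "contained_in K H \<longleftrightarrow>
     ordered_hypergraph K \<and>
     (\<exists>L. sub_hypergraph L H \<and> verts L = verts K \<and> ord L = ord K \<and>
       (\<exists>(t::nat) d f. bij_betw d {1..t} (edges L) \<and> bij_betw f {1..t} (edges K) \<and>
         (\<forall>i\<in>{1..t}. f i \<subseteq> d i)))"

definition iso_rel :: "'a ordered_hypergraph rel" where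
  "iso_rel = {(G, H). ordered_hypergraph G \<and> ordered_hypergraph H \<and>
     (\<exists>f. bij_betw f (verts G) (verts H) \<and>
       (\<forall>x\<in>verts G. \<forall>y\<in>verts G. (x, y) \<in> ord G \<longleftrightarrow> (f x, f y) \<in> ord H) \<and>
       edges H = (\<lambda>e. f ` e) ` edges G)}"

text \<open>
  Since vertex sets are finite, every ordered hypergraph is isomorphic to one whose vertices are
  natural numbers. An isomorphism-closed collection is therefore represented by the set of its
  members with vertices in \<open>nat\<close>; the order on the vertices is arbitrary.
\<close>

definition hypergraph_property :: "nat ordered_hypergraph set \<Rightarrow> bool" where
  "hypergraph_property P \<longleftrightarrow>
     (\<forall>H\<in>P. ordered_hypergraph H) \<and> (\<forall>H\<in>P. \<forall>K. (H, K) \<in> iso_rel \<longrightarrow> K \<in> P)"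

definition strongly_monotone :: "nat ordered_hypergraph set \<Rightarrow> bool" where
  "strongly_monotone P \<longleftrightarrow>
     hypergraph_property P \<and> (\<forall>H\<in>P. \<forall>K. contained_in K H \<longrightarrow> K \<in> P)"

definition speed :: "nat ordered_hypergraph set \<Rightarrow> nat \<Rightarrow> nat" where
  "speed P n = card ({H \<in> P. card (verts H) = n} // iso_rel)"

definition bounded_part ::
    "nat ordered_hypergraph set \<Rightarrow> enat \<Rightarrow> enat \<Rightarrow> nat ordered_hypergraph set" where
  "bounded_part P k l =
     {G \<in> P. (\<forall>v\<in>verts G. enat (card {e \<in> edges G. v \<in> e}) \<le> k) \<and>
             (\<forall>e\<in>edges G. enat (card e) \<le> l)}"

definition perm_hypergraph :: "nat \<Rightarrow> (nat \<Rightarrow> nat) \<Rightarrow> nat ordered_hypergraph" where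
  "perm_hypergraph k \<pi> =
     \<lparr>verts = {1..2 * k},
      edges = (\<lambda>i. {i, \<pi> i + k}) ` {1..k},
      ord = {(i, j). i \<in> {1..2 * k} \<and> j \<in> {1..2 * k} \<and> i \<le> j}\<rparr>"

definition extremal_speed :: "nat \<Rightarrow> nat" where
  "extremal_speed n = (\<Sum>k = 0..n div 2. (n choose (2 * k)) * fact k)"

text \<open>The speed is a cardinality of a quotient by a genuine equivalence relation.\<close>

lemma equiv_iso_rel: "equiv {H. ordered_hypergraph H} (iso_rel :: 'a ordered_hypergraph rel)"
proof (rule equivI)
  show "iso_rel \<subseteq> {H :: 'a ordered_hypergraph. ordered_hypergraph H} \<times> {H. ordered_hypergraph H}"
    by (auto simp: iso_rel_def)
  show "refl_on {H :: 'a ordered_hypergraph. ordered_hypergraph H} iso_rel"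
    unfolding refl_on_def iso_rel_def
    by (auto intro!: exI[of _ "\<lambda>x. x"] simp: bij_betw_def)
  show "sym (iso_rel :: 'a ordered_hypergraph rel)"
  proof (rule symI)
    fix G H :: "'a ordered_hypergraph"
    assume GH: "(G, H) \<in> iso_rel"
    obtain f where wf: "ordered_hypergraph G" "ordered_hypergraph H"
      and f: "bij_betw f (verts G) (verts H)"
      and o: "\<forall>x\<in>verts G. \<forall>y\<in>verts G. (x, y) \<in> ord G \<longleftrightarrow> (f x, f y) \<in> ord H"
      and e: "edges H = (\<lambda>e. f ` e) ` edges G"
      using GH unfolding iso_rel_def mem_Collect_eq case_prod_conv
      by (elim conjE exE) (rule that)
    define g where "g = inv_into (verts G) f"
    have g: "bij_betw g (verts H) (verts G)"
      unfolding g_def by (rule bij_betw_inv_into[OF f])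
    have fg: "f (g y) = y" if "y \<in> verts H" for y
      unfolding g_def using bij_betw_inv_into_right[OF f that] .
    have gv: "g y \<in> verts G" if "y \<in> verts H" for y
      using bij_betw_apply[OF g that] .
    have gf: "g ` f ` A = A" if "A \<in> edges G" for A
    proof -
      have A: "A \<subseteq> verts G" using that wf(1) by (simp add: ordered_hypergraph_def)
      have "g (f x) = x" if "x \<in> A" for x
        unfolding g_def using A that by (intro bij_betw_inv_into_left[OF f]) blast
      then show ?thesis by (simp add: image_image)
    qed
    have "edges G = (\<lambda>e. g ` e) ` edges H"
      unfolding e image_image[of _ _ "edges G"] by (simp add: gf cong: image_cong)
    moreover have "\<forall>x\<in>verts H. \<forall>y\<in>verts H. (x, y) \<in> ord H \<longleftrightarrow> (g x, g y) \<in> ord G"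
      using o by (simp add: gv fg)
    ultimately show "(H, G) \<in> iso_rel"
      unfolding iso_rel_def mem_Collect_eq case_prod_conv
      by (intro conjI exI[of _ g] wf g)
  qed
  show "trans (iso_rel :: 'a ordered_hypergraph rel)"
  proof (rule transI)
    fix G H K :: "'a ordered_hypergraph"
    assume GH: "(G, H) \<in> iso_rel" and HK: "(H, K) \<in> iso_rel"
    obtain f where wf: "ordered_hypergraph G" "ordered_hypergraph H"
      and f: "bij_betw f (verts G) (verts H)"
      and o: "\<forall>x\<in>verts G. \<forall>y\<in>verts G. (x, y) \<in> ord G \<longleftrightarrow> (f x, f y) \<in> ord H"
      and e: "edges H = (\<lambda>e. f ` e) ` edges G"
      using GH unfolding iso_rel_def mem_Collect_eq case_prod_conv
      by (elim conjE exE) (rule that)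
    obtain g where wf': "ordered_hypergraph H" "ordered_hypergraph K"
      and g: "bij_betw g (verts H) (verts K)"
      and p: "\<forall>x\<in>verts H. \<forall>y\<in>verts H. (x, y) \<in> ord H \<longleftrightarrow> (g x, g y) \<in> ord K"
      and e': "edges K = (\<lambda>e. g ` e) ` edges H"
      using HK unfolding iso_rel_def mem_Collect_eq case_prod_conv
      by (elim conjE exE) (rule that)
    have "bij_betw (g \<circ> f) (verts G) (verts K)"
      using f g by (rule bij_betw_trans)
    moreover have "edges K = (\<lambda>e. (g \<circ> f) ` e) ` edges G"
      unfolding e e' image_image[of _ _ "edges G"] by (simp only: image_comp)
    moreover have "\<forall>x\<in>verts G. \<forall>y\<in>verts G. (x, y) \<in> ord G \<longleftrightarrow> ((g \<circ> f) x, (g \<circ> f) y) \<in> ord K"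
      using o p by (simp add: bij_betw_apply[OF f])
    ultimately show "(G, K) \<in> iso_rel"
      unfolding iso_rel_def mem_Collect_eq case_prod_conv
      by (intro conjI exI[of _ "g \<circ> f"] wf(1) wf'(2))
  qed
qed

end

theory Submission
  imports Defs "HOL-Real_Asymp.Real_Asymp"
begin

text \<open>
  If \<open>H(\<pi>)\<close> is missing from \<open>P\<close>, then the members of \<open>P\<close> avoid \<open>\<pi>\<close>, and the hypergraphs on \<open>n\<close>
  vertices avoiding \<open>\<pi>\<close> number at most \<open>c ^ n\<close>. Indeed, by the Marcus--Tardos theorem an avoiding
  graph has linearly many edges. A largest system of distinct representatives of pairs by edges
  carries this over to the number of edges of a hypergraph (the other edges are cliques of a sparse
  graph), and cutting edges into pieces of bounded size carries it over to the sum of the edge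
  sizes. Merging neighbouring vertices in pairs maps avoiders on \<open>2 * n\<close> vertices to avoiders on
  \<open>n\<close> vertices, and the linear bound on the sum of sizes makes the fibers of this map at most
  exponentially large.

  A property that contains all \<open>H(\<pi>)\<close> contains all matchings whose left endpoints precede all right
  endpoints. These form a strongly monotone property whose speed is exactly the lower bound; any
  property of this speed is superexponential, hence contains these matchings, and by counting
  contains nothing else.
\<close>

section \<open>The Marcus--Tardos theorem\<close>

text \<open>Containment asks for k different edges, one for each pair of the pattern, whereas one
  edge may cover many pairs and one pair may lie in many edges. The graph of all covered pairs
  therefore says nothing about avoidance: a single edge covers every pair of its vertices and yet
  contains no pattern of length 2. Distinct representatives are what lets an occurrence in a graph
  lift to distinct edges.

  The fibers of the merging map show why the sum of the edge sizes is the right quantity. An edge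
  over d is some subset of the at most \<open>2 * card d\<close> vertices merging into d, and only a
  constant number of edges lie over the same d, so recording them all costs a number of bits
  proportional to the sum of \<open>card d\<close>. A linear number of edges alone would allow a
  quadratic number of bits. Passing from n to 2n vertices thus costs a factor
  \<open>2 ^ (B * n)\<close> with B constant, and over the powers of 2 these exponents form a
  geometric sum.\<close>

lemma card_le_fibers:
  assumes "finite A" "finite B" "f ` A \<subseteq> B" "\<And>b. b \<in> B \<Longrightarrow> card {a \<in> A. f a = b} \<le> m"
  shows "card A \<le> m * card B"
proof -
  have "A = (\<Union>b\<in>B. {a \<in> A. f a = b})" using assms(3) by auto
  then have "card A \<le> (\<Sum>b\<in>B. card {a \<in> A. f a = b})"
    using card_UN_le[OF assms(2), of "\<lambda>b. {a \<in> A. f a = b}"] by simp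
  also have "\<dots> \<le> (\<Sum>b\<in>B. m)" using assms(4) by (rule sum_mono)
  finally show ?thesis by (simp add: mult.commute)
qed

section \<open>Increasing enumerations of finite sets of naturals\<close>

lemma strict_mono_enumeration:
  fixes X :: "nat set"
  assumes "finite X" "card X = k"
  obtains r where "strict_mono_on {1..k} r" "r ` {1..k} = X"
proof -
  define r where "r i = sorted_list_of_set X ! (i - 1)" for i
  have len: "length (sorted_list_of_set X) = k" using assms by simp
  have "strict_mono_on {1..k} r"
    unfolding strict_mono_on_def r_def using len
    by (auto intro!: sorted_wrt_nth_less[OF strict_sorted_list_of_set])
  moreover have "r ` {1..k} = X"
  proof -
    have "r ` {1..k} = (!) (sorted_list_of_set X) ` (\<lambda>i. i - 1) ` {1..k}"
      by (simp add: r_def image_image)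
    also have "(\<lambda>i. i - 1) ` {1..k} = {..<k}"
    proof (intro equalityI subsetI)
      fix x assume "x \<in> {..<k}"
      then show "x \<in> (\<lambda>i. i - 1) ` {1..k}" by (intro image_eqI[of _ _ "Suc x"]) auto
    qed auto
    also have "(!) (sorted_list_of_set X) ` {..<k} = set (sorted_list_of_set X)"
      using len by (auto simp: set_conv_nth)
    finally show ?thesis using assms by simp
  qed
  ultimately show thesis by (rule that)
qed

lemma strict_mono_selection:
  fixes X :: "nat set"
  assumes "finite X" "k \<le> card X"
  obtains r where "strict_mono_on {1..k} r" "r ` {1..k} \<subseteq> X"
proof -
  obtain Y where "Y \<subseteq> X" "card Y = k" by (meson assms(2) obtain_subset_with_card_n)
  then show thesis
    using that strict_mono_enumeration[of Y k] assms(1) by (metis finite_subset)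
qed

text \<open>Makes it harmless to contract by a monotone map: an occurrence in the image lifts to
  preimages, whichever are chosen.\<close>

lemma strict_mono_on_mono_reflect:
  fixes g :: "nat \<Rightarrow> nat"
  assumes "mono g" "strict_mono_on X (g \<circ> r)"
  shows "strict_mono_on X r"
proof (rule strict_mono_onI)
  fix x y assume "x \<in> X" "y \<in> X" "x < y"
  then have "g (r x) < g (r y)" using assms(2) by (auto simp: strict_mono_on_def)
  then show "r x < r y" using assms(1) by (meson linorder_not_le monoD)
qed

lemma mono_div: "mono (\<lambda>x::nat. x div q)"
  by (auto intro: monoI div_le_mono)

section \<open>Permutation patterns in 0-1 matrices\<close>

definition matrix_contains :: "nat \<Rightarrow> (nat \<Rightarrow> nat) \<Rightarrow> nat rel \<Rightarrow> bool" where
  "matrix_contains k \<pi> M \<longleftrightarrow>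
     (\<exists>r c. strict_mono_on {1..k} r \<and> strict_mono_on {1..k} c \<and> (\<forall>i\<in>{1..k}. (r i, c (\<pi> i)) \<in> M))"

lemma matrix_containsI:
  "\<lbrakk>strict_mono_on {1..k} r; strict_mono_on {1..k} c; \<And>i. i \<in> {1..k} \<Longrightarrow> (r i, c (\<pi> i)) \<in> M\<rbrakk>
    \<Longrightarrow> matrix_contains k \<pi> M"
  unfolding matrix_contains_def by blast

lemma matrix_containsE:
  assumes "matrix_contains k \<pi> M"
  obtains r c where "strict_mono_on {1..k} r" "strict_mono_on {1..k} c"
    "\<And>i. i \<in> {1..k} \<Longrightarrow> (r i, c (\<pi> i)) \<in> M"
  using assms unfolding matrix_contains_def by blast

text \<open>Transposition turns the matrix of \<pi> into that of its inverse. It carries the bound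
  on wide blocks over to blocks meeting many rows.\<close>

lemma matrix_contains_converse:
  assumes "\<pi> permutes {1..k}" "matrix_contains k (inv \<pi>) (M\<inverse>)"
  shows "matrix_contains k \<pi> M"
proof -
  obtain r c where rc: "strict_mono_on {1..k} r" "strict_mono_on {1..k} c"
    "\<And>i. i \<in> {1..k} \<Longrightarrow> (r i, c (inv \<pi> i)) \<in> M\<inverse>"
    using assms(2) by (rule matrix_containsE) blast
  have "(c i, r (\<pi> i)) \<in> M" if "i \<in> {1..k}" for i
    using rc(3)[of "\<pi> i"] permutes_in_image[OF assms(1), of i] that
    by (simp add: permutes_inverses[OF assms(1)])
  with rc show ?thesis by (blast intro: matrix_containsI)
qed

text \<open>Each entry of the occurrence is lifted on its own. The lifted column coordinates come
  indexed by the row of their entry, so composing with \<open>inv \<pi>\<close> makes them a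
  function of the column index; increasing order is then reflected from the image.\<close>

lemma matrix_contains_mono_image:
  assumes "mono g" "mono h" "matrix_contains k \<pi> (map_prod g h ` M)" and \<pi>: "\<pi> permutes {1..k}"
  shows "matrix_contains k \<pi> M"
proof -
  obtain r c where rc: "strict_mono_on {1..k} r" "strict_mono_on {1..k} c"
    "\<And>i. i \<in> {1..k} \<Longrightarrow> (r i, c (\<pi> i)) \<in> map_prod g h ` M"
    using assms(3) by (rule matrix_containsE) blast
  have "\<forall>i\<in>{1..k}. \<exists>x y. (x, y) \<in> M \<and> g x = r i \<and> h y = c (\<pi> i)"
    using rc(3) by fastforce
  then obtain x y where xy: "\<And>i. i \<in> {1..k} \<Longrightarrow> (x i, y i) \<in> M \<and> g (x i) = r i \<and> h (y i) = c (\<pi> i)"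
    by metis
  define z where "z = y \<circ> inv \<pi>"
  have z: "h (z j) = c j" if "j \<in> {1..k}" for j
    using xy[of "inv \<pi> j"] that permutes_in_image[OF permutes_inv[OF \<pi>], of j]
    by (simp add: z_def permutes_inverses[OF \<pi>])
  have "strict_mono_on {1..k} (g \<circ> x)" "strict_mono_on {1..k} (h \<circ> z)"
    using rc(1,2) xy z by (auto simp: strict_mono_on_def)
  then have "strict_mono_on {1..k} x" "strict_mono_on {1..k} z"
    using strict_mono_on_mono_reflect assms(1,2) by blast+
  then show ?thesis
  proof (rule matrix_containsI)
    fix i assume "i \<in> {1..k}"
    then show "(x i, z (\<pi> i)) \<in> M" using xy by (simp add: z_def permutes_inverses[OF \<pi>])
  qed
qed

text \<open>A block is called wide if it meets at least \<open>k\<close> columns. If \<open>k\<close> wide blocks of the same block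
  column met the same set of columns, then any pattern of length \<open>k\<close> could be read off from them.\<close>

lemma card_wide_blocks:
  assumes M: "finite M" "\<not> matrix_contains k \<pi> M" and \<pi>: "\<pi> permutes {1..k}" and q: "q > 0"
  defines "cols \<equiv> \<lambda>i j. {y. \<exists>x. (x, y) \<in> M \<and> x div q = i \<and> y div q = j}"
  shows "card {i \<in> (\<lambda>p. fst p div q) ` M. k \<le> card (cols i j)} \<le> k * 2 ^ q"
proof -
  let ?W = "{i \<in> (\<lambda>p. fst p div q) ` M. k \<le> card (cols i j)}"
  let ?J = "{j * q..<j * q + q}"
  have sub: "(\<lambda>i. cols i j) ` ?W \<subseteq> Pow ?J"
  proof -
    have "y \<in> ?J" if "y div q = j" for y
      using that q div_mult_mod_eq[of y q] mod_less_divisor[OF q, of y]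
      by (auto simp: mult.commute dest: sym)
    then show ?thesis by (auto simp: cols_def)
  qed
  have finW: "finite ?W" using M(1) by auto
  have "card {i \<in> ?W. cols i j = T} \<le> k" for T
  proof (rule ccontr)
    assume more: "\<not> ?thesis"
    then have "k \<le> card {i \<in> ?W. cols i j = T}" by simp
    moreover have "finite {i \<in> ?W. cols i j = T}" using finW by (rule rev_finite_subset) blast
    ultimately obtain b where b: "strict_mono_on {1..k} b" "b ` {1..k} \<subseteq> {i \<in> ?W. cols i j = T}"
      by (elim strict_mono_selection[rotated])
    have "{i \<in> ?W. cols i j = T} \<noteq> {}" using more by (metis card.empty le0)
    then have "k \<le> card T" "T \<subseteq> ?J" using sub by blast+
    moreover from this have "finite T" by (auto intro: finite_subset)
    ultimately obtain c where c: "strict_mono_on {1..k} c" "c ` {1..k} \<subseteq> T"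
      by (elim strict_mono_selection[rotated])
    have "\<exists>x. (x, c (\<pi> l)) \<in> M \<and> x div q = b l" if l: "l \<in> {1..k}" for l
    proof -
      have "c (\<pi> l) \<in> cols (b l) j"
        using b(2) c(2) l permutes_in_image[OF \<pi>, of l] by blast
      then show ?thesis by (auto simp: cols_def)
    qed
    then obtain x where x: "\<And>l. l \<in> {1..k} \<Longrightarrow> (x l, c (\<pi> l)) \<in> M \<and> x l div q = b l" by metis
    have "strict_mono_on {1..k} ((\<lambda>x. x div q) \<circ> x)"
      using b(1) x by (auto simp: strict_mono_on_def)
    from strict_mono_on_mono_reflect[OF mono_div this] c(1) x M(2) show False
      by (blast intro: matrix_containsI)
  qed
  \<comment> \<open>A block column consists of \<open>q\<close> columns, so at most
    \<open>2 ^ q\<close> column sets occur.\<close>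
  then have "card ?W \<le> k * card (Pow ?J)"
    by (intro card_le_fibers[OF finW _ sub]) auto
  then show ?thesis by (simp add: card_Pow)
qed

text \<open>\<open>B\<close> lists the nonempty \<open>q\<close>-by-\<open>q\<close> blocks. A block
  meeting fewer than \<open>k\<close> rows and fewer than \<open>k\<close> columns holds at most
  \<open>k * k\<close> entries. The other blocks may be full, with \<open>q * q\<close> entries, but
  each of the \<open>m\<close> block columns has at most \<open>k * 2 ^ q\<close> wide ones, and
  likewise each block row for the tall ones.\<close>

lemma marcus_tardos_step:
  assumes M: "M \<subseteq> {..<q * m} \<times> {..<q * m}" "\<not> matrix_contains k \<pi> M"
    and \<pi>: "\<pi> permutes {1..k}" and q: "q > 0"
  defines "B \<equiv> map_prod (\<lambda>x. x div q) (\<lambda>y. y div q) ` M"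
  shows "card M \<le> k * k * card B + 2 * (k * 2 ^ q * (q * q)) * m"
proof -
  define b where "b = map_prod (\<lambda>x::nat. x div q) (\<lambda>y::nat. y div q)"
  have B: "B = b ` M" by (simp add: B_def b_def)
  have finM: "finite M" using M(1) by (rule finite_subset) auto
  have lt: "x div q < m" if "x < q * m" for x
    using that q by (simp add: less_mult_imp_div_less mult.commute)
  have BM: "B \<subseteq> {..<m} \<times> {..<m}" using M(1) lt by (auto simp: B_def)
  define fib where "fib p = {z \<in> M. b z = p}" for p
  define cols where "cols i j = {y. \<exists>x. (x, y) \<in> M \<and> x div q = i \<and> y div q = j}" for i j
  define rows where "rows i j = {x. \<exists>y. (x, y) \<in> M \<and> x div q = i \<and> y div q = j}" for i j
  define W where "W = {(i, j) \<in> B. k \<le> card (cols i j)}"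
  define T where "T = {(i, j) \<in> B. k \<le> card (rows i j)}"
  have fin_rc: "finite (cols i j)" "finite (rows i j)" for i j
    by (rule finite_subset[of _ "snd ` M"], force simp: cols_def, simp add: finM)
       (rule finite_subset[of _ "fst ` M"], force simp: rows_def, simp add: finM)
  have finB: "finite B" using finM by (simp add: B)
  have finWT: "finite W" "finite T" by (auto simp: W_def T_def intro: finite_subset[OF _ finB])
  have card_W: "card W \<le> k * 2 ^ q * m"
  proof -
    have "card {p \<in> W. snd p = j} \<le> k * 2 ^ q" for j
    proof -
      have "card {p \<in> W. snd p = j} = card (fst ` {p \<in> W. snd p = j})"
        by (intro card_image[symmetric]) (auto simp: inj_on_def)
      also have "\<dots> \<le> card {i \<in> (\<lambda>p. fst p div q) ` M. k \<le> card (cols i j)}"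
        by (intro card_mono) (use finM in \<open>force simp: W_def B_def\<close>)+
      also have "\<dots> \<le> k * 2 ^ q"
        using card_wide_blocks[OF finM M(2) \<pi> q, of j] by (simp add: cols_def)
      finally show ?thesis .
    qed
    moreover have "snd ` W \<subseteq> {..<m}" using BM by (auto simp: W_def)
    ultimately have "card W \<le> k * 2 ^ q * card {..<m}"
      using finWT(1) by (intro card_le_fibers) auto
    then show ?thesis by simp
  qed
  have card_T: "card T \<le> k * 2 ^ q * m"
  proof -
    have "card {p \<in> T. fst p = i} \<le> k * 2 ^ q" for i
    proof -
      have "card {p \<in> T. fst p = i} = card (snd ` {p \<in> T. fst p = i})"
        by (intro card_image[symmetric]) (auto simp: inj_on_def)
      also have "\<dots> \<le> card {j \<in> (\<lambda>p. fst p div q) ` M\<inverse>. k \<le> card (rows i j)}"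
        by (intro card_mono) (use finM in \<open>force simp: T_def B_def\<close>)+
      also have "\<dots> \<le> k * 2 ^ q"
        using card_wide_blocks[of "M\<inverse>" k "inv \<pi>" q i] finM M(2) matrix_contains_converse[OF \<pi>]
          permutes_inv[OF \<pi>] q by (auto simp: rows_def conj_commute)
      finally show ?thesis .
    qed
    moreover have "fst ` T \<subseteq> {..<m}" using BM by (auto simp: T_def)
    ultimately have "card T \<le> k * 2 ^ q * card {..<m}"
      using finWT(2) by (intro card_le_fibers) auto
    then show ?thesis by simp
  qed
  have fib_sub: "fib (i, j) \<subseteq> rows i j \<times> cols i j" for i j
    by (auto simp: fib_def rows_def cols_def b_def)
  have fib_le: "card (fib (i, j)) \<le> card (rows i j) * card (cols i j)" for i j
    using card_mono[OF _ fib_sub] fin_rc by (simp add: card_cartesian_product)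
  have fib_all: "card (fib p) \<le> q * q" for p
  proof -
    obtain i j where p: "p = (i, j)" by (cases p)
    have blk: "x \<in> {i * q..<i * q + q}" if "x div q = i" for x i
      using that q div_mult_mod_eq[of x q] mod_less_divisor[OF q, of x]
      by (auto simp: mult.commute dest: sym)
    have "card (rows i j) \<le> card {i * q..<i * q + q}" "card (cols i j) \<le> card {j * q..<j * q + q}"
      using blk by (intro card_mono; auto simp: rows_def cols_def)+
    then have "card (rows i j) * card (cols i j) \<le> q * q" by (intro mult_mono) auto
    then show ?thesis using fib_le[of i j] p by simp
  qed
  have "card M \<le> (\<Sum>p\<in>B. card (fib p))"
  proof -
    have "M = (\<Union>p\<in>B. fib p)" by (auto simp: B fib_def)
    then show ?thesis using card_UN_le[OF finB, of fib] by simp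
  qed
  also have "\<dots> \<le> (\<Sum>p\<in>B. k * k + (if p \<in> W \<union> T then q * q else 0))"
  proof (rule sum_mono)
    fix p assume p: "p \<in> B"
    show "card (fib p) \<le> k * k + (if p \<in> W \<union> T then q * q else 0)"
    proof (cases "p \<in> W \<union> T")
      case True
      then show ?thesis using fib_all[of p] by simp
    next
      case False
      obtain i j where ij: "p = (i, j)" by (cases p)
      have "card (rows i j) * card (cols i j) \<le> k * k"
        using False p ij by (intro mult_mono) (auto simp: W_def T_def)
      then show ?thesis using fib_le[of i j] ij by simp
    qed
  qed
  also have "\<dots> = k * k * card B + q * q * card (B \<inter> (W \<union> T))"
    using finB by (simp add: sum.distrib sum.If_cases Int_def)
  also have "card (B \<inter> (W \<union> T)) \<le> 2 * (k * 2 ^ q) * m"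
  proof -
    have "card (B \<inter> (W \<union> T)) \<le> card (W \<union> T)" using finWT by (intro card_mono) auto
    also have "\<dots> \<le> card W + card T" by (rule card_Un_le)
    finally show ?thesis using card_W card_T by simp
  qed
  finally show ?thesis by (simp add: algebra_simps)
qed

theorem marcus_tardos:
  assumes \<pi>: "\<pi> permutes {1..k}"
  obtains C where "\<And>n M. \<lbrakk>M \<subseteq> {..<n} \<times> {..<n}; \<not> matrix_contains k \<pi> M\<rbrakk> \<Longrightarrow> card M \<le> C * n"
proof (cases "k = 0")
  case True
  then have "matrix_contains k \<pi> M" for M by (auto simp: matrix_contains_def strict_mono_on_def)
  then show thesis using that by blast
next
  case False
  \<comment> \<open>With a linear bound \<open>D * m\<close> for the contracted matrix, the
    recursion yields \<open>k * k * (D * m) + D * m\<close>, which is exactly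
    \<open>D * (q * m)\<close> for this block size.\<close>
  define q where "q = k * k + 1"
  define D where "D = 2 * (k * 2 ^ q * (q * q))"
  have q: "q > 1" using False by (simp add: q_def)
  have D: "D \<ge> 1" using False q by (simp add: D_def Suc_le_eq)
  have pow: "card M \<le> D * q ^ j"
    if "M \<subseteq> {..<q ^ j} \<times> {..<q ^ j}" "\<not> matrix_contains k \<pi> M" for j M
    using that
  proof (induction j arbitrary: M)
    case 0
    then have "card M \<le> card ({..<1::nat} \<times> {..<1::nat})" by (intro card_mono) auto
    then show ?case using D by simp
  next
    case (Suc j)
    let ?B = "map_prod (\<lambda>x. x div q) (\<lambda>y. y div q) ` M"
    have "x div q < q ^ j" if "x < q * q ^ j" for x
      using that q by (simp add: less_mult_imp_div_less mult.commute)
    then have "?B \<subseteq> {..<q ^ j} \<times> {..<q ^ j}" using Suc.prems(1) by auto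
    moreover have "\<not> matrix_contains k \<pi> ?B"
      using matrix_contains_mono_image[OF mono_div mono_div _ \<pi>] Suc.prems(2) by blast
    ultimately have IH: "card ?B \<le> D * q ^ j" by (rule Suc.IH)
    have "card M \<le> k * k * card ?B + D * q ^ j"
      using marcus_tardos_step[OF _ Suc.prems(2) \<pi>, of q "q ^ j"] Suc.prems(1) q
      by (simp add: D_def)
    also have "\<dots> \<le> k * k * (D * q ^ j) + D * q ^ j" using IH by simp
    also have "\<dots> = D * q ^ Suc j" by (simp add: q_def algebra_simps)
    finally show ?case .
  qed
  show thesis
  proof (rule that)
    fix n M assume M: "M \<subseteq> {..<n} \<times> {..<n}" "\<not> matrix_contains k \<pi> M"
    show "card M \<le> D * q * n"
    proof (cases "n = 0")
      case True
      then show ?thesis using M(1) by simp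
    next
      case n: False
      \<comment> \<open>\<open>n\<close> is rounded up to a power of \<open>q\<close>; the overshoot
        is at most a factor \<open>q\<close>.\<close>
      then obtain j where j: "q ^ j \<le> n" "n < q ^ (j + 1)"
        using ex_power_ivl1[of q n] q by auto
      have "card M \<le> D * q ^ (j + 1)"
        using M j(2) by (intro pow) auto
      also have "\<dots> \<le> D * q * n" using j(1) by simp
      finally show ?thesis .
    qed
  qed
qed

section \<open>Ranks and compression to initial segments\<close>

definition rank :: "nat set \<Rightarrow> nat \<Rightarrow> nat" where
  "rank S x = card {y \<in> S. y < x}"

lemma mono_rank: "finite S \<Longrightarrow> mono (rank S)"
  unfolding rank_def by (intro monoI card_mono) auto

lemma rank_less: "\<lbrakk>finite S; x \<in> S\<rbrakk> \<Longrightarrow> rank S x < card S"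
  unfolding rank_def by (intro psubset_card_mono) auto

lemma strict_mono_on_rank:
  assumes "finite S"
  shows "strict_mono_on S (rank S)"
proof (rule strict_mono_onI)
  fix x y assume "x \<in> S" "y \<in> S" "x < y"
  then have "{z \<in> S. z < x} \<subset> {z \<in> S. z < y}" by auto
  then show "rank S x < rank S y" unfolding rank_def by (intro psubset_card_mono) (use assms in auto)
qed

lemma inj_on_rank: "finite S \<Longrightarrow> inj_on (rank S) S"
  using strict_mono_on_rank strict_mono_on_imp_inj_on by blast

lemma bij_betw_rank:
  assumes "finite S"
  shows "bij_betw (rank S) S {..<card S}"
proof -
  have "rank S ` S = {..<card S}"
    using assms rank_less inj_on_rank by (intro card_subset_eq) (auto simp: card_image)
  then show ?thesis using inj_on_rank[OF assms] by (simp add: bij_betw_def)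
qed

text \<open>The clique count needs the linear bound for the subgraph on every vertex subset, in
  terms of the size of that subset.\<close>

corollary marcus_tardos_on:
  assumes \<pi>: "\<pi> permutes {1..k}"
  obtains C where
    "\<And>S M. \<lbrakk>finite S; M \<subseteq> S \<times> S; \<not> matrix_contains k \<pi> M\<rbrakk> \<Longrightarrow> card M \<le> C * card S"
proof -
  obtain C where C: "\<And>n M. \<lbrakk>M \<subseteq> {..<n} \<times> {..<n}; \<not> matrix_contains k \<pi> M\<rbrakk> \<Longrightarrow> card M \<le> C * n"
    by (rule marcus_tardos[OF \<pi>]) blast
  show thesis
  proof (rule that)
    fix S M assume S: "finite S" "M \<subseteq> S \<times> S" "\<not> matrix_contains k \<pi> M"
    let ?g = "map_prod (rank S) (rank S)"
    have "inj_on ?g M"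
      using S(1,2) map_prod_inj_on[OF inj_on_rank inj_on_rank, of S S] inj_on_subset by blast
    then have "card M = card (?g ` M)" by (simp add: card_image)
    also have "\<dots> \<le> C * card S"
    proof (rule C)
      show "?g ` M \<subseteq> {..<card S} \<times> {..<card S}" using S rank_less by auto
      show "\<not> matrix_contains k \<pi> (?g ` M)"
        using matrix_contains_mono_image[OF mono_rank mono_rank _ \<pi>] S by blast
    qed
    finally show "card M \<le> C * card S" .
  qed
qed

section \<open>Hypergraphs avoiding a permutation\<close>

definition edge_sets :: "nat \<Rightarrow> nat set set set" where
  "edge_sets n = {E. \<forall>e\<in>E. e \<subseteq> {..<n} \<and> 2 \<le> card e}"

lemma edge_sets_subset: "edge_sets n \<subseteq> Pow (Pow {..<n})"
  by (auto simp: edge_sets_def)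

lemma finite_edge_sets: "finite (edge_sets n)"
  using edge_sets_subset by (rule finite_subset) simp

lemma finite_edge_set: "E \<in> edge_sets n \<Longrightarrow> finite E"
  by (rule finite_subset[of _ "Pow {..<n}"]) (auto simp: edge_sets_def)

lemma finite_edge: "\<lbrakk>E \<in> edge_sets n; e \<in> E\<rbrakk> \<Longrightarrow> finite e"
  by (auto simp: edge_sets_def intro: finite_subset[of _ "{..<n}"])

text \<open>An occurrence of \<open>perm_hypergraph k \<pi>\<close>: \<open>a\<close> and
  \<open>b\<close> place its left and right half, and \<open>e\<close> assigns edges. These must be
  distinct as edges of \<open>E\<close> but may agree on the chosen vertices, which is why edges are
  later shrunk before vertices are deleted.\<close>

definition edges_contain :: "nat \<Rightarrow> (nat \<Rightarrow> nat) \<Rightarrow> nat set set \<Rightarrow> bool" where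
  "edges_contain k \<pi> E \<longleftrightarrow>
     (\<exists>a b e. strict_mono_on {1..k} a \<and> strict_mono_on {1..k} b \<and>
        (\<forall>i\<in>{1..k}. \<forall>j\<in>{1..k}. a i < b j) \<and> inj_on e {1..k} \<and>
        (\<forall>i\<in>{1..k}. e i \<in> E \<and> a i \<in> e i \<and> b (\<pi> i) \<in> e i))"

lemma edges_containI:
  assumes "strict_mono_on {1..k} a" "strict_mono_on {1..k} b"
    "\<And>i j. \<lbrakk>i \<in> {1..k}; j \<in> {1..k}\<rbrakk> \<Longrightarrow> a i < b j"
    "inj_on e {1..k}" "\<And>i. i \<in> {1..k} \<Longrightarrow> e i \<in> E \<and> a i \<in> e i \<and> b (\<pi> i) \<in> e i"
  shows "edges_contain k \<pi> E"
  unfolding edges_contain_def using assms by blast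

lemma edges_containE:
  assumes "edges_contain k \<pi> E"
  obtains a b e where "strict_mono_on {1..k} a" "strict_mono_on {1..k} b"
    "\<And>i j. \<lbrakk>i \<in> {1..k}; j \<in> {1..k}\<rbrakk> \<Longrightarrow> a i < b j"
    "inj_on e {1..k}" "\<And>i. i \<in> {1..k} \<Longrightarrow> e i \<in> E \<and> a i \<in> e i \<and> b (\<pi> i) \<in> e i"
  using assms unfolding edges_contain_def by blast

lemma edges_contain_0: "edges_contain 0 \<pi> E"
  by (auto simp: edges_contain_def strict_mono_on_def)

text \<open>Edges of \<open>E\<close> with different images are different, so lifting each edge of
  the occurrence keeps them distinct. Hence merging vertices preserves avoidance.\<close>

lemma edges_contain_mono_image:
  assumes g: "mono g" and c: "edges_contain k \<pi> E'" and E': "E' \<subseteq> (`) g ` E" and \<pi>: "\<pi> permutes {1..k}"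
  shows "edges_contain k \<pi> E"
proof -
  obtain a b e where abe: "strict_mono_on {1..k} a" "strict_mono_on {1..k} b"
    "\<And>i j. \<lbrakk>i \<in> {1..k}; j \<in> {1..k}\<rbrakk> \<Longrightarrow> a i < b j"
    "inj_on e {1..k}" "\<And>i. i \<in> {1..k} \<Longrightarrow> e i \<in> E' \<and> a i \<in> e i \<and> b (\<pi> i) \<in> e i"
    using c by (rule edges_containE) blast
  have "\<forall>i\<in>{1..k}. \<exists>d x y. d \<in> E \<and> g ` d = e i \<and> x \<in> d \<and> g x = a i \<and> y \<in> d \<and> g y = b (\<pi> i)"
  proof
    fix i assume "i \<in> {1..k}"
    then have i: "e i \<in> E'" "a i \<in> e i" "b (\<pi> i) \<in> e i" using abe(5) by blast+
    from i(1) have "e i \<in> (`) g ` E" using E' by (rule rev_subsetD)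
    then obtain d where "d \<in> E" "g ` d = e i" by (metis imageE)
    with i(2,3) show "\<exists>d x y. d \<in> E \<and> g ` d = e i \<and> x \<in> d \<and> g x = a i \<and> y \<in> d \<and> g y = b (\<pi> i)"
      by (metis imageE)
  qed
  then obtain d x y where d: "\<And>i. i \<in> {1..k} \<Longrightarrow>
      d i \<in> E \<and> g ` d i = e i \<and> x i \<in> d i \<and> g (x i) = a i \<and> y i \<in> d i \<and> g (y i) = b (\<pi> i)"
    by metis
  define z where "z = y \<circ> inv \<pi>"
  have z: "g (z j) = b j" if "j \<in> {1..k}" for j
    using d[of "inv \<pi> j"] that permutes_in_image[OF permutes_inv[OF \<pi>], of j]
    by (simp add: z_def permutes_inverses[OF \<pi>])
  show ?thesis
  proof (rule edges_containI)
    have "strict_mono_on {1..k} (g \<circ> x)" "strict_mono_on {1..k} (g \<circ> z)"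
      using abe(1,2) d z by (auto simp: strict_mono_on_def)
    then show "strict_mono_on {1..k} x" "strict_mono_on {1..k} z"
      using strict_mono_on_mono_reflect[OF g] by blast+
    show "x i < z j" if "i \<in> {1..k}" "j \<in> {1..k}" for i j
    proof -
      have "g (x i) < g (z j)" using abe(3)[OF that] d z that by simp
      then show ?thesis using g by (meson linorder_not_le monoD)
    qed
    show "inj_on d {1..k}" using abe(4) d by (metis inj_on_def)
    show "d i \<in> E \<and> x i \<in> d i \<and> z (\<pi> i) \<in> d i" if "i \<in> {1..k}" for i
      using d[OF that] by (simp add: z_def permutes_inverses[OF \<pi>])
  qed
qed

text \<open>Every edge in \<open>K\<close> covers all of \<open>W\<close>, so each can serve any
  pair from \<open>W\<close>, and edges may be assigned to pairs arbitrarily. The first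
  \<open>k\<close> points of \<open>W\<close> become left endpoints, the next \<open>k\<close> right
  endpoints. The map \<open>g\<close> will be the identity for edges sharing a piece and halving for
  edges with a common image.\<close>

lemma edges_contain_common:
  fixes g :: "nat \<Rightarrow> nat"
  assumes g: "mono g" and W: "finite W" "2 * k \<le> card W"
    and K: "finite K" "K \<subseteq> E" "k \<le> card K" "\<And>e. e \<in> K \<Longrightarrow> W \<subseteq> g ` e"
    and \<pi>: "\<pi> permutes {1..k}"
  shows "edges_contain k \<pi> E"
proof -
  obtain r where r: "strict_mono_on {1..2 * k} r" "r ` {1..2 * k} \<subseteq> W"
    by (rule strict_mono_selection[OF W])
  obtain K' where "K' \<subseteq> K" "card K' = k" using K(3) obtain_subset_with_card_n by metis
  then obtain e where e: "bij_betw e {1..k} K'" using K(1)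
    by (metis ex_bij_betw_nat_finite_1 finite_subset)
  have eK: "e i \<in> K" if "i \<in> {1..k}" for i
    using e that \<open>K' \<subseteq> K\<close> by (auto simp: bij_betw_def)
  have "\<forall>i\<in>{1..k}. \<exists>x y. x \<in> e i \<and> g x = r i \<and> y \<in> e i \<and> g y = r (k + \<pi> i)"
  proof
    fix i assume i: "i \<in> {1..k}"
    then have "\<pi> i \<in> {1..k}" by (simp only: permutes_in_image[OF \<pi>])
    then have "r i \<in> W" "r (k + \<pi> i) \<in> W" using r(2) i by auto
    then have "r i \<in> g ` e i" "r (k + \<pi> i) \<in> g ` e i" using K(4)[OF eK[OF i]] by blast+
    then show "\<exists>x y. x \<in> e i \<and> g x = r i \<and> y \<in> e i \<and> g y = r (k + \<pi> i)"
      by (metis imageE)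
  qed
  then obtain x y where xy: "\<And>i. i \<in> {1..k} \<Longrightarrow> x i \<in> e i \<and> g (x i) = r i \<and> y i \<in> e i \<and> g (y i) = r (k + \<pi> i)"
    by metis
  define z where "z = y \<circ> inv \<pi>"
  have z: "g (z j) = r (k + j)" if "j \<in> {1..k}" for j
    using xy[of "inv \<pi> j"] that permutes_in_image[OF permutes_inv[OF \<pi>], of j]
    by (simp add: z_def permutes_inverses[OF \<pi>])
  show ?thesis
  proof (rule edges_containI)
    have "strict_mono_on {1..k} (g \<circ> x)" "strict_mono_on {1..k} (g \<circ> z)"
      using r(1) xy z by (auto simp: strict_mono_on_def)
    then show "strict_mono_on {1..k} x" "strict_mono_on {1..k} z"
      using strict_mono_on_mono_reflect[OF g] by blast+
    show "x i < z j" if "i \<in> {1..k}" "j \<in> {1..k}" for i j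
    proof -
      have "r i < r (k + j)" using r(1) that by (auto simp: strict_mono_on_def)
      then have "g (x i) < g (z j)" using xy z that by simp
      then show ?thesis using g by (meson linorder_not_le monoD)
    qed
    show "inj_on e {1..k}" using e by (simp add: bij_betw_def)
    show "e i \<in> E \<and> x i \<in> e i \<and> z (\<pi> i) \<in> e i" if "i \<in> {1..k}" for i
      using xy[OF that] eK[OF that] K(2) by (auto simp: z_def permutes_inverses[OF \<pi>])
  qed
qed

text \<open>A vertex of degree at most \<open>2 * D\<close> lies in at most \<open>2 ^ (2 * D)\<close> cliques; remove it.\<close>

lemma card_cliques:
  fixes G :: "nat rel"
  assumes "finite S" "\<And>T. T \<subseteq> S \<Longrightarrow> card (G \<inter> T \<times> T) \<le> D * card T"
  shows "card {e. e \<subseteq> S \<and> e \<noteq> {} \<and> (\<forall>x\<in>e. \<forall>y\<in>e. x < y \<longrightarrow> (x, y) \<in> G)} \<le> card S * 2 ^ (2 * D)"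
  using assms
proof (induction S rule: finite_remove_induct)
  case empty
  have no: "{e. e \<subseteq> {} \<and> e \<noteq> {} \<and> (\<forall>x\<in>e. \<forall>y\<in>e. x < y \<longrightarrow> (x, y) \<in> G)} = ({} :: nat set set)" by auto
  show ?case unfolding no by simp
next
  case (remove S)
  define cl where "cl S = {e. e \<subseteq> S \<and> e \<noteq> {} \<and> (\<forall>x\<in>e. \<forall>y\<in>e. x < y \<longrightarrow> (x, y) \<in> G)}" for S
  define N where "N v = {u \<in> S. (u, v) \<in> G \<or> (v, u) \<in> G}" for v
  have finN: "finite (N v)" for v using remove.hyps by (simp add: N_def)
  \<comment> \<open>Otherwise the degrees would sum to more than \<open>2 * D * card S\<close>, but
    every pair of \<open>G\<close> inside \<open>S\<close> is counted at most twice.\<close>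
  have "\<exists>v\<in>S. card (N v) \<le> 2 * D"
  proof (rule ccontr)
    assume neg: "\<not> ?thesis"
    let ?G = "G \<inter> S \<times> S"
    have finG: "finite ?G" using remove.hyps by blast
    have "(\<Sum>v\<in>S. 2 * D + 1) \<le> (\<Sum>v\<in>S. card (N v))"
      by (rule sum_mono) (use neg in \<open>auto simp: not_le Suc_le_eq\<close>)
    also have "\<dots> = card (SIGMA v:S. N v)" using remove.hyps finN by simp
    also have "\<dots> \<le> card (?G \<union> ?G\<inverse>)" using finG by (intro card_mono) (auto simp: N_def)
    also have "\<dots> \<le> card ?G + card ?G" using card_Un_le[of ?G "?G\<inverse>"] by simp
    also have "\<dots> \<le> 2 * (D * card S)" using remove.prems[of S] by simp
    finally have "card S = 0" by (simp add: algebra_simps)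
    then show False using remove.hyps by simp
  qed
  then obtain v where v: "v \<in> S" "card (N v) \<le> 2 * D" by blast
  have "cl S \<subseteq> insert v ` Pow (N v) \<union> cl (S - {v})"
  proof
    fix e assume e: "e \<in> cl S"
    show "e \<in> insert v ` Pow (N v) \<union> cl (S - {v})"
    proof (cases "v \<in> e")
      case True
      have "e - {v} \<subseteq> N v"
      proof
        fix u assume u: "u \<in> e - {v}"
        then have "u < v \<or> v < u" by auto
        with u True e show "u \<in> N v" by (auto simp: N_def cl_def)
      qed
      then show ?thesis using True by (intro UnI1 image_eqI[of _ _ "e - {v}"]) auto
    next
      case False
      then show ?thesis using e by (auto simp: cl_def)
    qed
  qed
  moreover have "finite (cl (S - {v}))"
  proof (rule finite_subset)
    show "cl (S - {v}) \<subseteq> Pow S" unfolding cl_def by blast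
    show "finite (Pow S)" using remove.hyps by simp
  qed
  ultimately have "card (cl S) \<le> card (insert v ` Pow (N v) \<union> cl (S - {v}))"
    using finN by (intro card_mono) auto
  also have "\<dots> \<le> card (insert v ` Pow (N v)) + card (cl (S - {v}))" by (rule card_Un_le)
  also have "card (insert v ` Pow (N v)) \<le> 2 ^ card (N v)"
    using card_image_le[of "Pow (N v)" "insert v"] finN by (simp add: card_Pow)
  also have "(2::nat) ^ card (N v) \<le> 2 ^ (2 * D)" using v(2) by simp
  also have "card (cl (S - {v})) \<le> card (S - {v}) * 2 ^ (2 * D)"
    unfolding cl_def using v(1) remove.prems by (intro remove.IH) auto
  also have "2 ^ (2 * D) + card (S - {v}) * 2 ^ (2 * D) = card S * 2 ^ (2 * D)"
    unfolding card_Suc_Diff1[OF remove.hyps(1) v(1), symmetric] by simp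
  finally show ?case by (simp add: cl_def)
qed

text \<open>Putting a new last row, with its entry in a new first column, below a permutation matrix
  forces all rows of an occurrence above the diagonal to lie before all its columns.\<close>

definition shifted :: "nat \<Rightarrow> (nat \<Rightarrow> nat) \<Rightarrow> nat \<Rightarrow> nat" where
  "shifted k \<pi> i = (if i \<in> {1..k} then \<pi> i + 1 else if i = k + 1 then 1 else i)"

lemma shifted_permutes:
  assumes "\<pi> permutes {1..k}"
  shows "shifted k \<pi> permutes {1..k + 1}"
proof (rule bij_imp_permutes)
  have in_range: "\<pi> i \<in> {1..k}" if "i \<in> {1..k}" for i using that by (simp only: permutes_in_image[OF assms])
  have "inj_on (shifted k \<pi>) {1..k + 1}"
    using in_range permutes_inj[OF assms]
    by (intro inj_onI) (fastforce simp: shifted_def inj_eq split: if_splits)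
  moreover have "shifted k \<pi> ` {1..k + 1} \<subseteq> {1..k + 1}"
    using in_range by (fastforce simp: shifted_def)
  ultimately show "bij_betw (shifted k \<pi>) {1..k + 1} {1..k + 1}"
    by (simp add: bij_betw_def endo_inj_surj)
  show "shifted k \<pi> i = i" if "i \<notin> {1..k + 1}" for i using that by (auto simp: shifted_def)
qed

text \<open>The injective \<open>\<phi>\<close> turns the \<open>k\<close> pairs of an occurrence in
  the graph into \<open>k\<close> different edges. The extra entry of the extended pattern serves to
  separate rows from columns and is then discarded.\<close>

lemma edges_contain_if_matrix_contains:
  assumes G: "matrix_contains (k + 1) (shifted k \<pi>) G" "\<And>x y. (x, y) \<in> G \<Longrightarrow> x < y"
    and \<phi>: "inj_on \<phi> G" "\<And>x y. (x, y) \<in> G \<Longrightarrow> \<phi> (x, y) \<in> E \<and> x \<in> \<phi> (x, y) \<and> y \<in> \<phi> (x, y)"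
  shows "edges_contain k \<pi> E"
proof -
  obtain r c where rc: "strict_mono_on {1..k + 1} r" "strict_mono_on {1..k + 1} c"
    "\<And>i. i \<in> {1..k + 1} \<Longrightarrow> (r i, c (shifted k \<pi> i)) \<in> G"
    using G(1) by (rule matrix_containsE) blast
  have G': "(r i, c (\<pi> i + 1)) \<in> G" if "i \<in> {1..k}" for i
    using rc(3)[of i] that by (simp add: shifted_def)
  show ?thesis
  proof (rule edges_containI)
    show "strict_mono_on {1..k} r" "strict_mono_on {1..k} (\<lambda>j. c (j + 1))"
      using rc(1,2) by (auto simp: strict_mono_on_def)
    show "r i < c (j + 1)" if "i \<in> {1..k}" "j \<in> {1..k}" for i j
    proof -
      have "r i < r (k + 1)" "c 1 < c (j + 1)"
        using rc(1,2) that by (auto simp: strict_mono_on_def)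
      moreover have "r (k + 1) < c 1" using rc(3)[of "k + 1"] G(2) by (simp add: shifted_def)
      ultimately show ?thesis by simp
    qed
    show "inj_on (\<lambda>i. \<phi> (r i, c (\<pi> i + 1))) {1..k}"
    proof (rule inj_onI)
      fix i j assume ij: "i \<in> {1..k}" "j \<in> {1..k}" "\<phi> (r i, c (\<pi> i + 1)) = \<phi> (r j, c (\<pi> j + 1))"
      then have "r i = r j" using \<phi>(1) G' by (auto dest: inj_onD)
      then show "i = j" using ij(1,2) strict_mono_on_imp_inj_on[OF rc(1)] by (auto dest: inj_onD)
    qed
    show "\<phi> (r i, c (\<pi> i + 1)) \<in> E \<and> r i \<in> \<phi> (r i, c (\<pi> i + 1)) \<and> c (\<pi> i + 1) \<in> \<phi> (r i, c (\<pi> i + 1))"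
      if "i \<in> {1..k}" for i
      using \<phi>(2) G'[OF that] by blast
  qed
qed

text \<open>Choose a largest family of pairs with distinct representatives among the edges. The edges
  that represent no pair are then cliques of the graph formed by these pairs.\<close>

lemma card_edges_linear:
  assumes \<pi>: "\<pi> permutes {1..k}"
  obtains C where "\<And>n E. \<lbrakk>E \<in> edge_sets n; \<not> edges_contain k \<pi> E\<rbrakk> \<Longrightarrow> card E \<le> C * n"
proof -
  obtain D where D: "\<And>S M. \<lbrakk>finite S; M \<subseteq> S \<times> S; \<not> matrix_contains (k + 1) (shifted k \<pi>) M\<rbrakk>
      \<Longrightarrow> card M \<le> D * card S"
    by (rule marcus_tardos_on[OF shifted_permutes[OF \<pi>]]) blast
  show thesis
  proof (rule that)
    fix n E assume E: "E \<in> edge_sets n" "\<not> edges_contain k \<pi> E"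
    define good where "good G \<phi> \<longleftrightarrow> inj_on \<phi> G \<and>
      (\<forall>(x, y)\<in>G. x < y \<and> \<phi> (x, y) \<in> E \<and> x \<in> \<phi> (x, y) \<and> y \<in> \<phi> (x, y))" for G and \<phi> :: "nat \<times> nat \<Rightarrow> nat set"
    define \<G> where "\<G> = {G. G \<subseteq> {..<n} \<times> {..<n} \<and> (\<exists>\<phi>. good G \<phi>)}"
    have "finite \<G>" by (rule finite_subset[of _ "Pow ({..<n} \<times> {..<n})"]) (auto simp: \<G>_def)
    moreover have "{} \<in> \<G>" by (simp add: \<G>_def good_def)
    \<comment> \<open>Maximal under inclusion, since the argument only ever tries to add a single
      pair.\<close>
    ultimately obtain G where G: "G \<in> \<G>" "\<And>G'. \<lbrakk>G' \<in> \<G>; G \<subseteq> G'\<rbrakk> \<Longrightarrow> G = G'"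
      using finite_has_maximal[of \<G>] by blast
    then obtain \<phi> where Gn: "G \<subseteq> {..<n} \<times> {..<n}" and \<phi>: "good G \<phi>" by (auto simp: \<G>_def)
    have free: "\<not> matrix_contains (k + 1) (shifted k \<pi>) G'" if "G' \<subseteq> G" for G'
    proof
      assume "matrix_contains (k + 1) (shifted k \<pi>) G'"
      then have "edges_contain k \<pi> E"
        by (rule edges_contain_if_matrix_contains[where \<phi> = \<phi>])
           (use \<phi> that in \<open>auto simp: good_def intro: inj_on_subset\<close>)
      with E(2) show False ..
    qed
    let ?cl = "{e. e \<subseteq> {..<n} \<and> e \<noteq> {} \<and> (\<forall>x\<in>e. \<forall>y\<in>e. x < y \<longrightarrow> (x, y) \<in> G)}"
    have "E - \<phi> ` G \<subseteq> ?cl"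
    proof
      fix e assume e: "e \<in> E - \<phi> ` G"
      then have en: "e \<subseteq> {..<n}" "2 \<le> card e" using E(1) by (auto simp: edge_sets_def)
      moreover have "(x, y) \<in> G" if xy: "x \<in> e" "y \<in> e" "x < y" for x y
      proof (rule ccontr)
        assume new: "(x, y) \<notin> G"
        \<comment> \<open>\<open>e\<close> does not yet represent a pair, so it can represent
          \<open>(x, y)\<close>, against maximality.\<close>
        have "good (insert (x, y) G) (\<phi>((x, y) := e))"
        proof -
          have "inj_on (\<phi>((x, y) := e)) (insert (x, y) G)"
            using \<phi> e new by (auto simp: good_def inj_on_def)
          then show ?thesis using \<phi> e new xy by (auto simp: good_def)
        qed
        then have "insert (x, y) G \<in> \<G>" using Gn xy en(1) by (auto simp: \<G>_def)
        from G(2)[OF this] new show False by blast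
      qed
      ultimately show "e \<in> ?cl" by auto
    qed
    then have "card (E - \<phi> ` G) \<le> card ?cl" by (intro card_mono) auto
    also have "\<dots> \<le> card {..<n} * 2 ^ (2 * D)"
    proof (rule card_cliques)
      fix T assume "T \<subseteq> {..<n}"
      then show "card (G \<inter> T \<times> T) \<le> D * card T"
        by (intro D) (auto intro: free[THEN notE] finite_subset[of _ "{..<n}"])
    qed simp
    finally have "card (E - \<phi> ` G) \<le> 2 ^ (2 * D) * n" by (simp add: mult.commute)
    moreover have "card (\<phi> ` G) \<le> D * n"
    proof -
      have "finite G" using Gn by (rule finite_subset) simp
      then have "card (\<phi> ` G) \<le> card G" by (rule card_image_le)
      also have "\<dots> \<le> D * n" using D[of "{..<n}" G] Gn free by simp
      finally show ?thesis .
    qed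
    moreover have "card E \<le> card (\<phi> ` G) + card (E - \<phi> ` G)"
    proof -
      have "card E \<le> card (\<phi> ` G \<union> (E - \<phi> ` G))"
        using finite_edge_set[OF E(1)] finite_subset[OF Gn] by (intro card_mono) auto
      also have "\<dots> \<le> card (\<phi> ` G) + card (E - \<phi> ` G)" by (rule card_Un_le)
      finally show ?thesis .
    qed
    ultimately show "card E \<le> (D + 2 ^ (2 * D)) * n" by (simp add: algebra_simps)
  qed
qed

section \<open>Total edge size of an avoiding hypergraph\<close>

definition piece :: "nat \<Rightarrow> nat set \<Rightarrow> nat \<Rightarrow> nat set" where
  "piece w e j = {x \<in> e. rank e x div w = j}"

lemma card_piece:
  assumes "finite e" "w > 0" "j < card e div w"
  shows "card (piece w e j) = w"
proof -
  have "rank e ` piece w e j = {i \<in> {..<card e}. i div w = j}"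
    using bij_betw_rank[OF assms(1)] by (auto simp: piece_def bij_betw_def)
  also have "\<dots> = {j * w..<j * w + w}"
  proof -
    have "j * w + w \<le> card e"
    proof -
      have "(j + 1) * w \<le> card e div w * w" using assms(3) by (intro mult_right_mono) auto
      also have "\<dots> \<le> card e" by simp
      finally show ?thesis by simp
    qed
    moreover have "i div w = j \<longleftrightarrow> i \<in> {j * w..<j * w + w}" for i
    proof
      assume "i div w = j"
      then have "i = j * w + i mod w" using div_mult_mod_eq[of i w] by metis
      then show "i \<in> {j * w..<j * w + w}"
        using mod_less_divisor[OF assms(2), of i] unfolding atLeastLessThan_iff by linarith
    qed (intro div_nat_eqI; simp add: mult.commute)
    ultimately show ?thesis by (intro set_eqI) (simp, linarith)
  qed
  finally have "card (rank e ` piece w e j) = w" by simp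
  moreover have "inj_on (rank e) (piece w e j)"
    using inj_on_rank[OF assms(1)] by (rule inj_on_subset) (auto simp: piece_def)
  ultimately show ?thesis by (simp add: card_image)
qed

lemma piece_subset: "piece w e j \<subseteq> e"
  by (auto simp: piece_def)

lemma piece_separated:
  assumes "finite e" "x \<in> piece w e i" "y \<in> piece w e j" "i < j"
  shows "x < y"
proof (rule ccontr)
  assume "\<not> x < y"
  then have "rank e y \<le> rank e x" using mono_rank[OF assms(1)] by (simp add: monoD)
  then have "rank e y div w \<le> rank e x div w" by (rule div_le_mono)
  with assms show False by (simp add: piece_def)
qed

text \<open>Every edge is cut into consecutive pieces of size \<open>2 * k\<close>. Two pieces of one edge are
  separated, so at most one of them reaches from the left to the right half of a copy of the pattern.\<close>

lemma sum_card_edges_linear: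
  assumes \<pi>: "\<pi> permutes {1..k}"
  obtains C where "\<And>n E. \<lbrakk>E \<in> edge_sets n; \<not> edges_contain k \<pi> E\<rbrakk> \<Longrightarrow> (\<Sum>e\<in>E. card e) \<le> C * n"
proof -
  obtain D where D: "\<And>n E. \<lbrakk>E \<in> edge_sets n; \<not> edges_contain k \<pi> E\<rbrakk> \<Longrightarrow> card E \<le> D * n"
    by (rule card_edges_linear[OF \<pi>]) blast
  define w where "w = 2 * k"
  show thesis
  proof (rule that)
    fix n E assume E: "E \<in> edge_sets n" "\<not> edges_contain k \<pi> E"
    have k: "k > 0" using E(2) edges_contain_0 by (metis gr0I)
    then have w: "w \<ge> 2" by (simp add: w_def)
    \<comment> \<open>Only full pieces are used; a shorter rest at the end of an edge is left out
      and paid for by the number of edges.\<close>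
    define I where "I = (SIGMA e:E. {..<card e div w})"
    define E' where "E' = (\<lambda>(e, j). piece w e j) ` I"
    have finE: "finite E" using E(1) by (rule finite_edge_set)
    have fin: "finite e" if "e \<in> E" for e using E(1) that by (rule finite_edge)
    have finI: "finite I" using finE by (simp add: I_def)
    have "E' \<in> edge_sets n"
    proof -
      have "piece w e j \<subseteq> {..<n} \<and> 2 \<le> card (piece w e j)" if "e \<in> E" "j < card e div w" for e j
      proof -
        have "e \<subseteq> {..<n}" using E(1) that(1) by (auto simp: edge_sets_def)
        then show ?thesis using w that piece_subset card_piece[OF fin] by fastforce
      qed
      then show ?thesis by (auto simp: edge_sets_def E'_def I_def)
    qed
    moreover have "\<not> edges_contain k \<pi> E'"
    proof
      assume "edges_contain k \<pi> E'"
      then obtain a b p where abp: "strict_mono_on {1..k} a" "strict_mono_on {1..k} b"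
        "\<And>i j. \<lbrakk>i \<in> {1..k}; j \<in> {1..k}\<rbrakk> \<Longrightarrow> a i < b j"
        "inj_on p {1..k}" "\<And>i. i \<in> {1..k} \<Longrightarrow> p i \<in> E' \<and> a i \<in> p i \<and> b (\<pi> i) \<in> p i"
        by (rule edges_containE) blast
      have "\<forall>i\<in>{1..k}. \<exists>e j. e \<in> E \<and> p i = piece w e j" using abp(5) by (fastforce simp: E'_def I_def)
      then obtain e j where ej: "\<And>i. i \<in> {1..k} \<Longrightarrow> e i \<in> E \<and> p i = piece w (e i) (j i)" by metis
      have "inj_on e {1..k}"
      proof (rule inj_onI, rule ccontr)
        fix i i' assume i: "i \<in> {1..k}" "i' \<in> {1..k}" "e i = e i'" "i \<noteq> i'"
        have "j i \<noteq> j i'" using i ej abp(4) by (metis inj_onD)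
        then have "b (\<pi> i) < a i' \<or> b (\<pi> i') < a i"
          using i ej abp(5) fin piece_separated[of "e i"] by (metis linorder_neqE_nat)
        moreover have "\<pi> i \<in> {1..k}" "\<pi> i' \<in> {1..k}" using i by (simp_all only: permutes_in_image[OF \<pi>])
        ultimately show False using abp(3) i by (meson less_asym)
      qed
      moreover have "e i \<in> E \<and> a i \<in> e i \<and> b (\<pi> i) \<in> e i" if "i \<in> {1..k}" for i
        using ej[OF that] abp(5)[OF that] by (auto simp: piece_def)
      ultimately show False using E(2) abp(1-3) by (blast intro: edges_containI)
    qed
    ultimately have E'n: "card E' \<le> D * n" by (rule D)
    \<comment> \<open>Different edges may share a piece. The piece size \<open>2 * k\<close> is
      chosen for this point: \<open>k\<close> edges through a common piece of that size already
      contain the pattern.\<close>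
    have "card {q \<in> I. (\<lambda>(e, j). piece w e j) q = p} \<le> k" if p: "p \<in> E'" for p
    proof (rule ccontr)
      let ?Q = "{q \<in> I. (\<lambda>(e, j). piece w e j) q = p}"
      assume "\<not> ?thesis"
      then have "k \<le> card ?Q" by simp
      obtain e0 j0 where p0: "p = piece w e0 j0" "e0 \<in> E" "j0 < card e0 div w"
        using p by (auto simp: E'_def I_def)
      have cp: "card p = w" using p0 w by (simp add: card_piece fin)
      then have pne: "finite p" "p \<noteq> {}" using w card.infinite by fastforce+
      \<comment> \<open>A nonempty piece determines its index within an edge.\<close>
      have "inj_on fst ?Q"
        using pne(2) by (auto simp: inj_on_def piece_def)
      then have "card ?Q = card (fst ` ?Q)" by (simp add: card_image)
      moreover have "edges_contain k \<pi> E" if "k \<le> card (fst ` ?Q)"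
      proof (rule edges_contain_common[where g = id and W = p and K = "fst ` ?Q"])
        show "finite (fst ` ?Q)" using finI by simp
        show "fst ` ?Q \<subseteq> E" by (auto simp: I_def)
        show "p \<subseteq> id ` e" if "e \<in> fst ` ?Q" for e using that by (auto simp: piece_def)
      qed (use cp pne that \<pi> in \<open>auto simp: w_def mono_def\<close>)
      ultimately show False using E(2) \<open>k \<le> card ?Q\<close> by simp
    qed
    then have "card I \<le> k * card E'"
      using finI by (intro card_le_fibers[where f = "\<lambda>(e, j). piece w e j"]) (auto simp: E'_def)
    also have "\<dots> \<le> k * (D * n)" using E'n by simp
    finally have I: "card I \<le> k * (D * n)" .
    have "(\<Sum>e\<in>E. card e) \<le> (\<Sum>e\<in>E. w * (card e div w) + w)"
    proof (rule sum_mono)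
      fix e
      have "card e = w * (card e div w) + card e mod w" by simp
      then show "card e \<le> w * (card e div w) + w"
        using mod_less_divisor[of w "card e"] w by linarith
    qed
    also have "\<dots> = w * card I + w * card E"
      using finE by (simp add: I_def sum.distrib sum_distrib_left)
    also have "\<dots> \<le> w * (k * (D * n)) + w * (D * n)"
      using I D[OF E] by (intro add_mono mult_left_mono) auto
    finally show "(\<Sum>e\<in>E. card e) \<le> (w * k * D + w * D) * n" by (simp add: algebra_simps)
  qed
qed

section \<open>Merging neighbouring vertices and counting avoiders\<close>

definition avoiders :: "nat \<Rightarrow> (nat \<Rightarrow> nat) \<Rightarrow> nat \<Rightarrow> nat set set set" where
  "avoiders k \<pi> n = {E \<in> edge_sets n. \<not> edges_contain k \<pi> E}"

lemma finite_avoiders: "finite (avoiders k \<pi> n)"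
  unfolding avoiders_def using finite_edge_sets by simp

lemma avoiders_mono: "m \<le> n \<Longrightarrow> avoiders k \<pi> m \<subseteq> avoiders k \<pi> n"
  unfolding avoiders_def edge_sets_def by force

text \<open>Edges collapsing to one point are dropped. As an edge has at least two vertices, these
  are exactly the pairs \<open>{2 * i, 2 * i + 1}\<close>, which are recorded separately when
  \<open>E\<close> is reconstructed.\<close>

definition halve :: "nat set set \<Rightarrow> nat set set" where
  "halve E = {d \<in> (\<lambda>e. (\<lambda>x. x div 2) ` e) ` E. 2 \<le> card d}"

definition preimage2 :: "nat set \<Rightarrow> nat set" where
  "preimage2 d = {x. x div 2 \<in> d}"

lemma preimage2_eq: "preimage2 d = (*) 2 ` d \<union> (\<lambda>x. 2 * x + 1) ` d"
proof (intro equalityI subsetI)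
  fix x assume "x \<in> preimage2 d"
  then have "x div 2 \<in> d" by (simp add: preimage2_def)
  moreover have "x = 2 * (x div 2) \<or> x = 2 * (x div 2) + 1" by presburger
  ultimately show "x \<in> (*) 2 ` d \<union> (\<lambda>x. 2 * x + 1) ` d" by blast
qed (auto simp: preimage2_def)

lemma preimage2:
  assumes "finite d"
  shows "finite (preimage2 d)" "card (preimage2 d) \<le> 2 * card d"
proof -
  show "finite (preimage2 d)" using assms by (simp add: preimage2_eq)
  have "card (preimage2 d) \<le> card ((*) 2 ` d) + card ((\<lambda>x. 2 * x + 1) ` d)"
    unfolding preimage2_eq by (rule card_Un_le)
  also have "\<dots> \<le> card d + card d" using assms by (intro add_mono card_image_le)
  finally show "card (preimage2 d) \<le> 2 * card d" by simp
qed

lemma halve_avoiders: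
  assumes "E \<in> avoiders k \<pi> (2 * n)" and \<pi>: "\<pi> permutes {1..k}"
  shows "halve E \<in> avoiders k \<pi> n"
proof -
  have "\<not> edges_contain k \<pi> (halve E)"
    using assms(1) edges_contain_mono_image[where g = "\<lambda>x. x div 2" and E' = "halve E" and E = E, OF mono_div _ _ \<pi>]
    by (auto simp: avoiders_def halve_def)
  moreover have "halve E \<in> edge_sets n"
    using assms(1) by (fastforce simp: avoiders_def edge_sets_def halve_def less_mult_imp_div_less mult.commute)
  ultimately show ?thesis by (simp add: avoiders_def)
qed

text \<open>Over an image with at least \<open>2 * k\<close> points, \<open>k\<close> edges would
  contain the pattern. Over a smaller image all edges are subsets of fewer than \<open>4 * k\<close>
  vertices when \<open>k\<close> is positive, so their number is at most \<open>2 ^ (4 * k)\<close>;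
  this is the stated bound, and it exceeds \<open>k\<close>.\<close>

lemma card_halve_fiber:
  assumes E: "E \<in> avoiders k \<pi> (2 * n)" and \<pi>: "\<pi> permutes {1..k}" and d: "d \<in> halve E"
  shows "card {e \<in> E. (\<lambda>x. x div 2) ` e = d} \<le> 4 ^ (2 * k)"
proof -
  let ?F = "{e \<in> E. (\<lambda>x. x div 2) ` e = d}"
  have find: "finite d" using d by (auto simp: halve_def intro: card_ge_0_finite)
  have finE: "finite E" using E by (auto simp: avoiders_def intro: finite_edge_set)
  show ?thesis
  proof (cases "2 * k \<le> card d")
    case True
    have "card ?F < k"
    proof (rule ccontr)
      assume "\<not> card ?F < k"
      then have "edges_contain k \<pi> E"
        by (intro edges_contain_common[OF mono_div[of 2] find True _ _ _ _ \<pi>, of ?F]) (use finE in auto)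
      then show False using E by (simp add: avoiders_def)
    qed
    also have "k \<le> 2 * k" by simp
    also have "2 * k < 4 ^ (2 * k)" by (rule power_gt_expt) simp
    finally show ?thesis by simp
  next
    case False
    have "?F \<subseteq> Pow (preimage2 d)" by (auto simp: preimage2_def)
    then have "card ?F \<le> 2 ^ card (preimage2 d)"
      using card_mono[of "Pow (preimage2 d)" ?F] preimage2(1)[OF find] by (simp add: card_Pow)
    also have "\<dots> \<le> 2 ^ (2 * (2 * k))"
      using preimage2(2)[OF find] False by (intro power_increasing) auto
    also have "\<dots> = 4 ^ (2 * k)" by (subst power_mult) simp
    finally show ?thesis .
  qed
qed

text \<open>Padding with repetitions gives every fiber the same index set \<open>{..<L}\<close>, so
  one bound on triples serves all fibers. Repetitions disappear again because only the set of edges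
  is rebuilt.\<close>

lemma enumerate_with_repetition:
  assumes "finite F" "F \<noteq> {}" "card F \<le> L"
  shows "\<exists>f. F = f ` {..<L}"
proof -
  obtain h where h: "bij_betw h {0..<card F} F" using ex_bij_betw_nat_finite[OF assms(1)] by blast
  have pos: "card F > 0" using assms(1,2) by (simp add: card_gt_0_iff)
  have "F = (\<lambda>i. if i < card F then h i else h 0) ` {..<L}"
  proof (intro equalityI subsetI)
    fix x assume "x \<in> F"
    then obtain i where "i < card F" "x = h i" using h by (force simp: bij_betw_def)
    then show "x \<in> (\<lambda>i. if i < card F then h i else h 0) ` {..<L}"
      using assms(3) by (intro image_eqI[of _ _ i]) auto
  next
    fix x assume "x \<in> (\<lambda>i. if i < card F then h i else h 0) ` {..<L}"
    then show "x \<in> F" using h pos by (auto simp: bij_betw_def)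
  qed
  then show ?thesis by blast
qed

text \<open>\<open>E\<close> is recovered from \<open>halve E\<close>, the edges collapsing to a point, and a set of triples
  \<open>(l, d, x)\<close> stating that \<open>x\<close> belongs to the \<open>l\<close>-th edge collapsing to \<open>d\<close>.\<close>

lemma card_avoiders_double:
  assumes \<pi>: "\<pi> permutes {1..k}"
    and D: "\<And>E. E \<in> avoiders k \<pi> n \<Longrightarrow> (\<Sum>e\<in>E. card e) \<le> D * n"
  defines "L \<equiv> 4 ^ (2 * k)"
  shows "card (avoiders k \<pi> (2 * n)) \<le> card (avoiders k \<pi> n) * 2 ^ ((1 + L * (2 * D)) * n)"
proof -
  define pt where "pt = (\<lambda>i::nat. {2 * i, 2 * i + 1}) ` {..<n}"
  define I where "I H = {..<L} \<times> (SIGMA d:H. preimage2 d)" for H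
  define dec where "dec H = (\<lambda>(A, S). A \<union> (\<lambda>(l, d). {x::nat. (l, d, x) \<in> S}) ` ({..<L} \<times> H))"
    for H :: "nat set set"
  define Z where "Z H = dec H ` (Pow pt \<times> Pow (I H))" for H
  have finI: "finite (I H) \<and> card (I H) \<le> L * (2 * D) * n" if H: "H \<in> avoiders k \<pi> n" for H
  proof -
    have HE: "H \<in> edge_sets n" using H by (simp add: avoiders_def)
    have fin: "finite H" "\<And>d. d \<in> H \<Longrightarrow> finite d"
      using finite_edge_set[OF HE] finite_edge[OF HE] by blast+
    have "card (SIGMA d:H. preimage2 d) = (\<Sum>d\<in>H. card (preimage2 d))"
      using fin preimage2(1) by simp
    also have "\<dots> \<le> (\<Sum>d\<in>H. 2 * card d)" using fin preimage2(2) by (intro sum_mono) auto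
    also have "\<dots> \<le> 2 * (D * n)" using D[OF H] by (simp flip: sum_distrib_left)
    finally have "L * card (SIGMA d:H. preimage2 d) \<le> L * (2 * (D * n))" by (rule mult_left_mono) simp
    moreover have "finite (I H)" using fin preimage2(1) by (auto simp: I_def)
    ultimately show ?thesis by (simp add: I_def card_cartesian_product)
  qed
  have pt: "finite pt" "card pt \<le> n"
    using card_image_le[of "{..<n}" "\<lambda>i::nat. {2 * i, 2 * i + 1}"] by (auto simp: pt_def)
  have Z: "finite (Z H) \<and> card (Z H) \<le> 2 ^ ((1 + L * (2 * D)) * n)" if H: "H \<in> avoiders k \<pi> n" for H
  proof -
    have fin: "finite (Pow pt \<times> Pow (I H))" using finI[OF H] pt(1) by blast
    then have "card (Z H) \<le> card (Pow pt \<times> Pow (I H))" unfolding Z_def by (rule card_image_le)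
    \<comment> \<open>One bit for each pair that can collapse and one for each possible
      triple.\<close>
    also have "\<dots> = 2 ^ (card pt + card (I H))"
      using finI[OF H] pt(1) by (simp add: card_cartesian_product card_Pow power_add)
    also have "\<dots> \<le> 2 ^ ((1 + L * (2 * D)) * n)"
      using finI[OF H] pt(2) by (intro power_increasing) (auto simp: algebra_simps)
    finally show ?thesis using fin by (simp add: Z_def)
  qed
  have "E \<in> Z (halve E)" if E: "E \<in> avoiders k \<pi> (2 * n)" for E
  proof -
    have es: "E \<in> edge_sets (2 * n)" using E by (simp add: avoiders_def)
    let ?fib = "\<lambda>d. {e \<in> E. (\<lambda>x. x div 2) ` e = d}"
    have "\<exists>f. ?fib d = f ` {..<L}" if d: "d \<in> halve E" for d
    proof (rule enumerate_with_repetition)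
      show "finite (?fib d)" using finite_edge_set[OF es] by simp
      show "?fib d \<noteq> {}" using d by (auto simp: halve_def)
      show "card (?fib d) \<le> L" unfolding L_def by (rule card_halve_fiber[OF E \<pi> d])
    qed
    then obtain f where f: "\<And>d. d \<in> halve E \<Longrightarrow> ?fib d = f d ` {..<L}" by metis
    define S where "S = {(l, d, x). l < L \<and> d \<in> halve E \<and> x \<in> f d l}"
    define A where "A = {e \<in> E. \<not> 2 \<le> card ((\<lambda>x. x div 2) ` e)}"
    have fib: "f d l \<in> ?fib d" if "d \<in> halve E" "l < L" for d l using f[OF that(1)] that(2) by blast
    have "A \<subseteq> pt"
    proof
      fix e assume "e \<in> A"
      then have e: "e \<in> E" "card ((\<lambda>x. x div 2) ` e) \<le> 1" by (auto simp: A_def)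
      then have e2: "e \<subseteq> {..<2 * n}" "2 \<le> card e" "finite e"
        using es finite_edge[OF es] by (auto simp: edge_sets_def)
      then have "e \<noteq> {}" by auto
      then have "card ((\<lambda>x. x div 2) ` e) \<noteq> 0" using e2(3) by simp
      then have "card ((\<lambda>x. x div 2) ` e) = 1" using e(2) by linarith
      then obtain i where i: "(\<lambda>x. x div 2) ` e = {i}" by (rule card_1_singletonE)
      have "e \<subseteq> {2 * i, 2 * i + 1}"
      proof
        fix x assume "x \<in> e"
        then have "x div 2 = i" using i by blast
        then have "x = 2 * i \<or> x = 2 * i + 1" by presburger
        then show "x \<in> {2 * i, 2 * i + 1}" by simp
      qed
      moreover from this have "e = {2 * i, 2 * i + 1}"
        using e2(2) by (intro card_seteq) auto
      moreover have "i < n" using e2(1) calculation(2) by auto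
      ultimately show "e \<in> pt" by (auto simp: pt_def)
    qed
    moreover have "S \<subseteq> I (halve E)" using fib by (fastforce simp: S_def I_def preimage2_def)
    moreover have "E = dec (halve E) (A, S)"
    proof -
      have "{x. (l, d, x) \<in> S} = f d l" if "l < L" "d \<in> halve E" for l d using that by (simp add: S_def)
      then have "(\<lambda>(l, d). {x. (l, d, x) \<in> S}) ` ({..<L} \<times> halve E) = (\<Union>d\<in>halve E. f d ` {..<L})"
        by (intro equalityI subsetI) (auto simp del: split_paired_Ex intro!: rev_image_eqI)
      also have "\<dots> = (\<Union>d\<in>halve E. ?fib d)" using f by simp
      also have "\<dots> = {e \<in> E. 2 \<le> card ((\<lambda>x. x div 2) ` e)}" by (auto simp: halve_def)
      finally show ?thesis by (auto simp: dec_def A_def)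
    qed
    ultimately show ?thesis unfolding Z_def by blast
  qed
  then have "avoiders k \<pi> (2 * n) \<subseteq> (\<Union>H\<in>avoiders k \<pi> n. Z H)"
    using halve_avoiders[OF _ \<pi>] by blast
  then have "card (avoiders k \<pi> (2 * n)) \<le> card (\<Union>H\<in>avoiders k \<pi> n. Z H)"
    using Z finite_avoiders by (intro card_mono) auto
  also have "\<dots> \<le> (\<Sum>H\<in>avoiders k \<pi> n. card (Z H))" by (rule card_UN_le[OF finite_avoiders])
  also have "\<dots> \<le> (\<Sum>H\<in>avoiders k \<pi> n. 2 ^ ((1 + L * (2 * D)) * n))" using Z by (intro sum_mono) auto
  finally show ?thesis by simp
qed

lemma edge_sets_trivial: "n \<le> 1 \<Longrightarrow> edge_sets n \<subseteq> {{}}"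
proof -
  assume n: "n \<le> 1"
  have "card e \<le> 1" if "e \<subseteq> {..<n}" for e using card_mono[OF _ that] n by simp
  moreover have "\<not> 2 \<le> m" if "m \<le> 1" for m :: nat using that by simp
  ultimately show ?thesis unfolding edge_sets_def by blast
qed

text \<open>The step from \<open>2 ^ j\<close> to \<open>2 ^ (j + 1)\<close> vertices costs a factor
  \<open>2 ^ (B * 2 ^ j)\<close>, equal to the whole bound reached so far, so the exponent doubles
  along with the number of vertices. Rounding \<open>n\<close> up to a power of 2 at most doubles it
  once more, whence the base \<open>2 ^ (2 * B)\<close>.\<close>

theorem card_avoiders_exponential:
  assumes \<pi>: "\<pi> permutes {1..k}"
  obtains c :: nat where "c > 0" "\<And>n. card (avoiders k \<pi> n) \<le> c ^ n"
proof -
  obtain D where D: "\<And>n E. \<lbrakk>E \<in> edge_sets n; \<not> edges_contain k \<pi> E\<rbrakk> \<Longrightarrow> (\<Sum>e\<in>E. card e) \<le> D * n"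
    by (rule sum_card_edges_linear[OF \<pi>]) blast
  define B :: nat where "B = 1 + 4 ^ (2 * k) * (2 * D)"
  have triv: "card (avoiders k \<pi> n) \<le> 1" if "n \<le> 1" for n
    using card_mono[of "{{}}" "avoiders k \<pi> n"] edge_sets_trivial[OF that] by (auto simp: avoiders_def)
  have pow: "card (avoiders k \<pi> (2 ^ j)) \<le> 2 ^ (B * 2 ^ j)" for j
  proof (induction j)
    case 0
    then show ?case using order_trans[OF triv[of 1] one_le_power[of "2::nat" B]] by simp
  next
    case (Suc j)
    have "card (avoiders k \<pi> (2 * 2 ^ j)) \<le> card (avoiders k \<pi> (2 ^ j)) * 2 ^ (B * 2 ^ j)"
      unfolding B_def by (rule card_avoiders_double[OF \<pi>]) (auto simp: avoiders_def intro: D)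
    also have "\<dots> \<le> 2 ^ (B * 2 ^ j) * 2 ^ (B * 2 ^ j)" using Suc.IH by (rule mult_right_mono) simp
    also have "\<dots> = 2 ^ (B * 2 ^ Suc j)" by (simp flip: power_add)
    finally show ?case by simp
  qed
  show thesis
  proof (rule that)
    show "card (avoiders k \<pi> n) \<le> (2 ^ (2 * B)) ^ n" for n
    proof (cases "n = 0")
      case True
      then show ?thesis using triv[of n] by simp
    next
      case False
      then obtain j where j: "2 ^ j \<le> n" "n < 2 ^ (j + 1)" using ex_power_ivl1[of 2 n] by auto
      have "card (avoiders k \<pi> n) \<le> card (avoiders k \<pi> (2 ^ (j + 1)))"
        using j(2) by (intro card_mono finite_avoiders avoiders_mono) simp
      also have "\<dots> \<le> 2 ^ (B * 2 ^ (j + 1))" by (rule pow)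
      also have "\<dots> \<le> 2 ^ (2 * B * n)" using j(1) by (intro power_increasing) auto
      finally show ?thesis by (simp add: power_mult)
    qed
  qed simp
qed

section \<open>Canonical representatives and speed\<close>

definition std :: "nat set \<Rightarrow> nat set set \<Rightarrow> nat ordered_hypergraph" where
  "std V E = \<lparr>verts = V, edges = E, ord = {(i, j). i \<in> V \<and> j \<in> V \<and> i \<le> j}\<rparr>"

lemma std_simps [simp]:
  "verts (std V E) = V" "edges (std V E) = E" "(i, j) \<in> ord (std V E) \<longleftrightarrow> i \<in> V \<and> j \<in> V \<and> i \<le> j"
  by (simp_all add: std_def)

lemma perm_hypergraph_std: "perm_hypergraph k \<pi> = std {1..2 * k} ((\<lambda>i. {i, \<pi> i + k}) ` {1..k})"
  by (simp add: perm_hypergraph_def std_def)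

lemma ordered_hypergraph_std:
  assumes "finite V" "\<And>e. e \<in> E \<Longrightarrow> e \<subseteq> V \<and> 2 \<le> card e"
  shows "ordered_hypergraph (std V E)"
proof -
  have "linear_order_on V (ord (std V E))"
    by (auto simp: linear_order_on_def partial_order_on_def preorder_on_def refl_on_def
        antisym_def trans_def total_on_def std_def)
  with assms show ?thesis by (simp add: ordered_hypergraph_def)
qed

lemma ordered_hypergraph_std_edge_sets: "E \<in> edge_sets n \<Longrightarrow> ordered_hypergraph (std {..<n} E)"
  by (rule ordered_hypergraph_std) (auto simp: edge_sets_def)

lemma iso_relI:
  assumes "ordered_hypergraph G" "ordered_hypergraph H" "bij_betw f (verts G) (verts H)"
    "\<And>x y. \<lbrakk>x \<in> verts G; y \<in> verts G\<rbrakk> \<Longrightarrow> (x, y) \<in> ord G \<longleftrightarrow> (f x, f y) \<in> ord H"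
    "edges H = (`) f ` edges G"
  shows "(G, H) \<in> iso_rel"
  using assms unfolding iso_rel_def by blast

lemma iso_relE:
  assumes "(G, H) \<in> iso_rel"
  obtains f where "ordered_hypergraph G" "ordered_hypergraph H" "bij_betw f (verts G) (verts H)"
    "\<And>x y. \<lbrakk>x \<in> verts G; y \<in> verts G\<rbrakk> \<Longrightarrow> (x, y) \<in> ord G \<longleftrightarrow> (f x, f y) \<in> ord H"
    "edges H = (`) f ` edges G"
  using assms unfolding iso_rel_def mem_Collect_eq case_prod_conv by (elim conjE exE) (rule that; blast)

lemma iso_rel_sym: "(G, H) \<in> iso_rel \<Longrightarrow> (H, G) \<in> iso_rel"
  using equiv_iso_rel unfolding equiv_def by (meson symD)

text \<open>An order isomorphism of \<open>{..<n}\<close> onto itself is the identity: it maps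
  \<open>{..<x}\<close> onto \<open>{..<f x}\<close>, and the sizes agree. So each isomorphism class
  has at most one member of this form.\<close>

lemma std_rigid:
  assumes "(std {..<n} E, std {..<n} E') \<in> iso_rel" "E \<in> edge_sets n"
  shows "E = E'"
proof -
  obtain f where f: "bij_betw f {..<n} {..<n}" and E': "E' = (`) f ` E"
    and o: "\<And>x y. \<lbrakk>x < n; y < n\<rbrakk> \<Longrightarrow> x \<le> y \<longleftrightarrow> f x \<le> f y"
    using assms(1) by (elim iso_relE) (auto dest: bij_betw_apply)
  have fx: "f x = x" if "x < n" for x
  proof -
    have "f ` {..<x} = {..<f x}"
    proof (intro equalityI subsetI)
      fix y assume y: "y \<in> {..<f x}"
      moreover have "f x < n" using f that by (auto dest: bij_betw_apply)
      ultimately have "y \<in> f ` {..<n}" using f by (simp add: bij_betw_def)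
      then obtain z where "z < n" "y = f z" by auto
      moreover from this have "z < x" using y o[of x z] that by (auto simp: not_le)
      ultimately show "y \<in> f ` {..<x}" by blast
    next
      fix y assume "y \<in> f ` {..<x}"
      then obtain z where "z < x" "y = f z" by auto
      then show "y \<in> {..<f x}" using o[of x z] that by auto
    qed
    moreover have "inj_on f {..<x}" using f that by (auto simp: bij_betw_def intro: inj_on_subset)
    ultimately show ?thesis using card_image[of f "{..<x}"] by simp
  qed
  have "f ` e = e" if "e \<in> E" for e
  proof -
    have "x < n" if "x \<in> e" for x using assms(2) \<open>e \<in> E\<close> that by (auto simp: edge_sets_def)
    then show ?thesis using fx by (metis image_cong image_ident)
  qed
  then show ?thesis using E' by simp
qed

text \<open>Sending each vertex to the number of vertices strictly below it replaces an arbitrary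
  order by the usual one on an initial segment.\<close>

lemma ex_iso_std:
  assumes H: "ordered_hypergraph H"
  obtains E where "E \<in> edge_sets (card (verts H))" "(H, std {..<card (verts H)} E) \<in> iso_rel"
proof -
  let ?V = "verts H" and ?r = "ord H"
  have fin: "finite ?V" and lin: "linear_order_on ?V ?r"
    using H by (auto simp: ordered_hypergraph_def)
  have r: "trans ?r" "antisym ?r" "total_on ?V ?r" "refl_on ?V ?r"
    using lin by (auto simp: linear_order_on_def partial_order_on_def preorder_on_def)
  define below where "below x = {y \<in> ?V. (y, x) \<in> ?r \<and> y \<noteq> x}" for x
  define f where "f x = card (below x)" for x
  have fb: "finite (below x)" for x using fin by (simp add: below_def)
  have le: "f x \<le> f y" if "(x, y) \<in> ?r" for x y
    unfolding f_def
  proof (rule card_mono[OF fb])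
    show "below x \<subseteq> below y" using r(1,2) that by (auto simp: below_def dest: transD antisymD)
  qed
  have lt: "f x < f y" if "(x, y) \<in> ?r" "x \<noteq> y" "x \<in> ?V" for x y
    unfolding f_def
  proof (rule psubset_card_mono[OF fb])
    have "below x \<subseteq> below y" using r(1,2) that by (auto simp: below_def dest: transD antisymD)
    moreover have "x \<in> below y - below x" using that by (simp add: below_def)
    ultimately show "below x \<subset> below y" by blast
  qed
  have iff: "(x, y) \<in> ?r \<longleftrightarrow> f x \<le> f y" if "x \<in> ?V" "y \<in> ?V" for x y
    using le lt that r(3,4) unfolding total_on_def refl_on_def by (metis leD)
  have inj: "inj_on f ?V"
    using iff r(2) by (intro inj_onI) (metis antisymD order_refl)
  have range: "f ` ?V \<subseteq> {..<card ?V}"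
  proof -
    have "f x < card ?V" if "x \<in> ?V" for x
      unfolding f_def by (rule psubset_card_mono[OF fin]) (use that in \<open>auto simp: below_def\<close>)
    then show ?thesis by auto
  qed
  then have "f ` ?V = {..<card ?V}" by (intro card_subset_eq) (auto simp: card_image inj)
  then have bij: "bij_betw f ?V {..<card ?V}" using inj by (simp add: bij_betw_def)
  have "(`) f ` edges H \<in> edge_sets (card ?V)"
  proof -
    have "f ` e \<subseteq> {..<card ?V} \<and> 2 \<le> card (f ` e)" if "e \<in> edges H" for e
    proof -
      have e: "e \<subseteq> ?V" "2 \<le> card e" using H that by (auto simp: ordered_hypergraph_def)
      moreover from this have "card (f ` e) = card e" using inj by (metis card_image inj_on_subset)
      ultimately show ?thesis using range by auto
    qed
    then show ?thesis by (auto simp: edge_sets_def)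
  qed
  moreover from this have "(H, std {..<card ?V} ((`) f ` edges H)) \<in> iso_rel"
    using H bij iff range by (intro iso_relI ordered_hypergraph_std_edge_sets) auto
  ultimately show thesis by (rule that)
qed

section \<open>Speed as a number of canonical edge sets\<close>

definition std_members :: "nat ordered_hypergraph set \<Rightarrow> nat \<Rightarrow> nat set set set" where
  "std_members P n = {E \<in> edge_sets n. std {..<n} E \<in> P}"

lemma finite_std_members: "finite (std_members P n)"
  unfolding std_members_def using finite_edge_sets by simp

lemma inj_on_std_class: "inj_on (\<lambda>E. iso_rel `` {std {..<n} E}) (edge_sets n)"
proof (rule inj_onI)
  fix E E' assume E: "E \<in> edge_sets n" "E' \<in> edge_sets n"
    and eq: "iso_rel `` {std {..<n} E} = iso_rel `` {std {..<n} E'}"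
  have "(std {..<n} E, std {..<n} E') \<in> iso_rel"
    using eq_equiv_class[OF eq equiv_iso_rel] ordered_hypergraph_std_edge_sets[OF E(2)] by simp
  then show "E = E'" using E(1) by (rule std_rigid)
qed

lemma quotient_subset_std_classes:
  assumes "\<And>H. H \<in> A \<Longrightarrow> ordered_hypergraph H \<and> card (verts H) = n"
  shows "A // iso_rel \<subseteq> (\<lambda>E. iso_rel `` {std {..<n} E}) ` edge_sets n"
proof
  fix X assume "X \<in> A // iso_rel"
  then obtain H where H: "H \<in> A" "X = iso_rel `` {H}" by (auto simp: quotient_def)
  then obtain E where E: "E \<in> edge_sets n" "(H, std {..<n} E) \<in> iso_rel"
    using assms[OF H(1)] ex_iso_std[of H] by blast
  then have "X = iso_rel `` {std {..<n} E}" using H(2) equiv_class_eq[OF equiv_iso_rel E(2)] by simp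
  with E(1) show "X \<in> (\<lambda>E. iso_rel `` {std {..<n} E}) ` edge_sets n" by blast
qed

text \<open>Formulated for any set of ordered hypergraphs, closed under isomorphism or not, so that
  it applies to \<open>bounded_part P 1 2\<close> directly. Without closure a class may be met only
  in noncanonical members, hence an inequality.\<close>

lemma
  assumes "\<And>H. H \<in> P \<Longrightarrow> ordered_hypergraph H"
  shows card_std_members_le_speed: "card (std_members P n) \<le> speed P n"
    and speed_mono: "Q \<subseteq> P \<Longrightarrow> speed Q n \<le> speed P n"
proof -
  let ?c = "\<lambda>E. iso_rel `` {std {..<n} E}" and ?A = "\<lambda>P. {H \<in> P. card (verts H) = n}"
  have "?A P // iso_rel \<subseteq> ?c ` edge_sets n"
    using assms by (intro quotient_subset_std_classes) auto
  then have fin: "finite (?A P // iso_rel)" using finite_edge_sets by (rule finite_subset[OF _ finite_imageI])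
  have "card (std_members P n) = card (?c ` std_members P n)"
    by (intro card_image[symmetric] inj_on_subset[OF inj_on_std_class]) (auto simp: std_members_def)
  also have "\<dots> \<le> speed P n"
    unfolding speed_def by (rule card_mono[OF fin]) (auto simp: std_members_def intro: quotientI)
  finally show "card (std_members P n) \<le> speed P n" .
  show "speed Q n \<le> speed P n" if "Q \<subseteq> P"
    unfolding speed_def by (rule card_mono[OF fin]) (use that in \<open>auto simp: quotient_def\<close>)
qed

lemma speed_eq_card_std_members:
  assumes P: "hypergraph_property P"
  shows "speed P n = card (std_members P n)"
proof (rule antisym)
  let ?c = "\<lambda>E. iso_rel `` {std {..<n} E}" and ?A = "{H \<in> P. card (verts H) = n}"
  have oh: "ordered_hypergraph H" if "H \<in> P" for H using P that by (auto simp: hypergraph_property_def)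
  have "?A // iso_rel \<subseteq> ?c ` std_members P n"
  proof
    fix X assume X: "X \<in> ?A // iso_rel"
    have "?A // iso_rel \<subseteq> ?c ` edge_sets n" using oh by (intro quotient_subset_std_classes) auto
    with X obtain E where E: "E \<in> edge_sets n" "X = ?c E" by blast
    obtain H where H: "H \<in> P" "X = iso_rel `` {H}" using X by (auto simp: quotient_def)
    have "(H, std {..<n} E) \<in> iso_rel"
      using H(2) E equiv_class_self[OF equiv_iso_rel, of "std {..<n} E"]
        ordered_hypergraph_std_edge_sets[OF E(1)] by simp
    then have "std {..<n} E \<in> P" using P H(1) by (auto simp: hypergraph_property_def)
    with E show "X \<in> ?c ` std_members P n" by (auto simp: std_members_def)
  qed
  then have "speed P n \<le> card (?c ` std_members P n)"
    unfolding speed_def by (intro card_mono finite_imageI finite_std_members)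
  also have "\<dots> \<le> card (std_members P n)" by (rule card_image_le[OF finite_std_members])
  finally show "speed P n \<le> card (std_members P n)" .
  show "card (std_members P n) \<le> speed P n" using oh by (rule card_std_members_le_speed)
qed

lemma property_subset_if_std_members_subset:
  assumes P: "hypergraph_property P" and Q: "hypergraph_property Q"
    and sub: "\<And>n. std_members P n \<subseteq> std_members Q n"
  shows "P \<subseteq> Q"
proof
  fix H assume H: "H \<in> P"
  then have "ordered_hypergraph H" using P by (auto simp: hypergraph_property_def)
  then obtain E where E: "E \<in> edge_sets (card (verts H))" "(H, std {..<card (verts H)} E) \<in> iso_rel"
    by (rule ex_iso_std)
  then have "E \<in> std_members P (card (verts H))"
    using P H by (auto simp: std_members_def hypergraph_property_def)
  then have "std {..<card (verts H)} E \<in> Q" using sub by (auto simp: std_members_def)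
  then show "H \<in> Q" using Q iso_rel_sym[OF E(2)] by (auto simp: hypergraph_property_def)
qed

text \<open>First shrink and delete edges, then restrict to the image of \<open>v\<close>: restricting first
  could identify different edges.\<close>

lemma strongly_monotone_embed:
  assumes P: "strongly_monotone P" and H: "std V E \<in> P"
    and U: "finite U" "strict_mono_on U v" "v ` U \<subseteq> V"
    and E': "\<And>e. e \<in> E' \<Longrightarrow> e \<subseteq> U \<and> 2 \<le> card e"
    and \<phi>: "inj_on \<phi> E'" "\<And>e. e \<in> E' \<Longrightarrow> \<phi> e \<in> E \<and> v ` e \<subseteq> \<phi> e"
  shows "std U E' \<in> P"
proof -
  have closed: "hypergraph_property P"
    and monotone: "\<And>H K. \<lbrakk>H \<in> P; contained_in K H\<rbrakk> \<Longrightarrow> K \<in> P"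
    using P by (auto simp: strongly_monotone_def)
  have oh: "ordered_hypergraph (std V E)" using closed H by (auto simp: hypergraph_property_def)
  have finV: "finite V" and E: "\<And>e. e \<in> E \<Longrightarrow> e \<subseteq> V \<and> 2 \<le> card e"
    using oh by (auto simp: ordered_hypergraph_def)
  have injv: "inj_on v U" using U(2) by (rule strict_mono_on_imp_inj_on)
  have cardv: "card (v ` e) = card e" if "e \<in> E'" for e
    using E'[OF that] injv by (metis card_image inj_on_subset)
  have injv': "inj_on ((`) v) E'"
    using inj_on_image_Pow[OF injv] by (rule inj_on_subset) (use E' in auto)
  have "finite E'" using E' U(1) by (intro finite_subset[of E' "Pow U"]) auto
  then obtain h where h: "bij_betw h {1..card E'} E'" using ex_bij_betw_nat_finite_1 by blast
  let ?F = "(`) v ` E'"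
  have F: "d \<subseteq> v ` U \<and> 2 \<le> card d" if "d \<in> ?F" for d using that E' cardv by auto
  have ohF: "ordered_hypergraph (std V ?F)" "ordered_hypergraph (std (v ` U) ?F)"
    by (intro ordered_hypergraph_std finV finite_imageI U(1) conjI F subset_trans[OF _ U(3)]
        F[THEN conjunct1] F[THEN conjunct2]; assumption)+
  \<comment> \<open>A containment matches the edges one to one, so \<open>E\<close> first loses all
    edges other than the chosen ones.\<close>
  have sub: "sub_hypergraph (std V (\<phi> ` E')) (std V E)"
  proof -
    have "ordered_hypergraph (std V (\<phi> ` E'))"
      using E \<phi>(2) finV by (intro ordered_hypergraph_std) auto
    moreover have "\<phi> ` E' \<subseteq> {e \<inter> V |e. e \<in> E \<and> 2 \<le> card (e \<inter> V)}"
    proof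
      fix d assume "d \<in> \<phi> ` E'"
      then have d: "d \<in> E" using \<phi>(2) by blast
      moreover from this have "d \<inter> V = d" using E by blast
      ultimately show "d \<in> {e \<inter> V |e. e \<in> E \<and> 2 \<le> card (e \<inter> V)}"
        using E[OF d] by (intro CollectI exI[of _ d]) simp
    qed
    ultimately show ?thesis using oh by (auto simp: sub_hypergraph_def std_def)
  qed
  have "contained_in (std V ?F) (std V E)"
    unfolding contained_in_def
  proof (intro conjI exI)
    show "sub_hypergraph (std V (\<phi> ` E')) (std V E)" by (rule sub)
    show "bij_betw (\<phi> \<circ> h) {1..card E'} (edges (std V (\<phi> ` E')))"
      using bij_betw_trans[OF h inj_on_imp_bij_betw[OF \<phi>(1)]] by simp
    show "bij_betw ((`) v \<circ> h) {1..card E'} (edges (std V ?F))"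
      using bij_betw_trans[OF h inj_on_imp_bij_betw[OF injv']] by simp
    show "\<forall>i\<in>{1..card E'}. ((`) v \<circ> h) i \<subseteq> (\<phi> \<circ> h) i"
      using \<phi>(2) bij_betw_apply[OF h] by auto
  qed (use ohF in \<open>auto simp: std_def\<close>)
  then have inP: "std V ?F \<in> P" using monotone H by blast
  \<comment> \<open>All edges now lie inside the image of \<open>v\<close>, so restriction leaves
    them unchanged and no two are identified.\<close>
  have "contained_in (std (v ` U) ?F) (std V ?F)"
    unfolding contained_in_def
  proof (intro conjI exI)
    have "?F \<subseteq> {e \<inter> v ` U |e. e \<in> ?F \<and> 2 \<le> card (e \<inter> v ` U)}"
    proof
      fix d assume d: "d \<in> ?F"
      then have "d \<inter> v ` U = d" using F by blast
      with d F[OF d] show "d \<in> {e \<inter> v ` U |e. e \<in> ?F \<and> 2 \<le> card (e \<inter> v ` U)}"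
        by (intro CollectI exI[of _ d]) metis
    qed
    then show "sub_hypergraph (std (v ` U) ?F) (std V ?F)"
      using ohF U(3) by (auto simp: sub_hypergraph_def std_def)
    show "bij_betw ((`) v \<circ> h) {1..card E'} (edges (std (v ` U) ?F))"
      using bij_betw_trans[OF h inj_on_imp_bij_betw[OF injv']] by simp
    show "bij_betw ((`) v \<circ> h) {1..card E'} (edges (std (v ` U) ?F))"
      using bij_betw_trans[OF h inj_on_imp_bij_betw[OF injv']] by simp
  qed (use ohF in auto)
  then have inP': "std (v ` U) ?F \<in> P" using monotone inP by blast
  have "(std U E', std (v ` U) ?F) \<in> iso_rel"
  proof (rule iso_relI)
    show "ordered_hypergraph (std U E')" using U(1) E' by (rule ordered_hypergraph_std)
    show "bij_betw v (verts (std U E')) (verts (std (v ` U) ?F))" using injv by (simp add: bij_betw_def)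
    show "(x, y) \<in> ord (std U E') \<longleftrightarrow> (v x, v y) \<in> ord (std (v ` U) ?F)"
      if "x \<in> verts (std U E')" "y \<in> verts (std U E')" for x y
      using that strict_mono_on_less_eq[OF U(2)] by auto
  qed (use ohF in auto)
  from iso_rel_sym[OF this] show ?thesis using closed inP' by (auto simp: hypergraph_property_def)
qed

lemma perm_hypergraph_mem_if_edges_contain:
  assumes P: "strongly_monotone P" and H: "std {..<n} E \<in> P" "E \<in> edge_sets n"
    and c: "edges_contain k \<pi> E" and \<pi>: "\<pi> permutes {1..k}"
  shows "perm_hypergraph k \<pi> \<in> P"
proof -
  obtain a b e where abe: "strict_mono_on {1..k} a" "strict_mono_on {1..k} b"
    "\<And>i j. \<lbrakk>i \<in> {1..k}; j \<in> {1..k}\<rbrakk> \<Longrightarrow> a i < b j"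
    "inj_on e {1..k}" "\<And>i. i \<in> {1..k} \<Longrightarrow> e i \<in> E \<and> a i \<in> e i \<and> b (\<pi> i) \<in> e i"
    using c by (rule edges_containE) blast
  define v where "v j = (if j \<le> k then a j else b (j - k))" for j
  \<comment> \<open>The edge \<open>{i, \<pi> i + k}\<close> has minimum \<open>i\<close>, so
    \<open>Min\<close> recovers the index that selects the edge.\<close>
  define \<phi> where "\<phi> d = e (Min d)" for d
  have rng: "\<pi> i \<in> {1..k}" if "i \<in> {1..k}" for i using that by (simp only: permutes_in_image[OF \<pi>])
  have Min: "Min {i, \<pi> i + k} = i" if "i \<in> {1..k}" for i using rng[OF that] that by simp
  have in_n: "x < n" if "x \<in> e i" "i \<in> {1..k}" for x i
    using H(2) abe(5) that by (auto simp: edge_sets_def)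
  show ?thesis
    unfolding perm_hypergraph_std
  proof (rule strongly_monotone_embed[OF P H(1)])
    show "strict_mono_on {1..2 * k} v"
    proof (rule strict_mono_onI)
      fix i j assume ij: "i \<in> {1..2 * k}" "j \<in> {1..2 * k}" "i < j"
      consider "j \<le> k" | "i \<le> k" "k < j" | "k < i" using ij(3) by linarith
      then show "v i < v j"
      proof cases
        case 1
        then show ?thesis using abe(1) ij by (simp add: v_def strict_mono_on_def)
      next
        case 2
        then have "i \<in> {1..k}" "j - k \<in> {1..k}" using ij by auto
        then show ?thesis using abe(3) 2 by (simp add: v_def)
      next
        case 3
        then show ?thesis using strict_mono_onD[OF abe(2), of "i - k" "j - k"] ij by (simp add: v_def)
      qed
    qed
    show "v ` {1..2 * k} \<subseteq> {..<n}"
    proof -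
      have "v j < n" if j: "j \<in> {1..2 * k}" for j
      proof (cases "j \<le> k")
        case True
        then show ?thesis using in_n abe(5) j by (auto simp: v_def)
      next
        case False
        then have jk: "j - k \<in> {1..k}" using j by auto
        then have i: "inv \<pi> (j - k) \<in> {1..k}" by (simp only: permutes_in_image[OF permutes_inv[OF \<pi>]])
        have "b (j - k) \<in> e (inv \<pi> (j - k))"
          using abe(5)[OF i] by (simp add: permutes_inverses[OF \<pi>])
        then show ?thesis using in_n[OF _ i] False by (simp add: v_def)
      qed
      then show ?thesis by auto
    qed
    show "d \<subseteq> {1..2 * k} \<and> 2 \<le> card d" if d: "d \<in> (\<lambda>i. {i, \<pi> i + k}) ` {1..k}" for d
    proof -
      obtain i where i: "i \<in> {1..k}" "d = {i, \<pi> i + k}" using d by blast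
      then have "i \<noteq> \<pi> i + k" using rng[OF i(1)] by auto
      then show ?thesis using i rng[OF i(1)] by auto
    qed
    show "inj_on \<phi> ((\<lambda>i. {i, \<pi> i + k}) ` {1..k})"
    proof (rule inj_on_imageI)
      have "inj_on (\<phi> \<circ> (\<lambda>i. {i, \<pi> i + k})) {1..k} \<longleftrightarrow> inj_on e {1..k}"
        by (rule inj_on_cong) (simp only: o_apply \<phi>_def Min)
      with abe(4) show "inj_on (\<phi> \<circ> (\<lambda>i. {i, \<pi> i + k})) {1..k}" by simp
    qed
    show "\<phi> d \<in> E \<and> v ` d \<subseteq> \<phi> d" if d: "d \<in> (\<lambda>i. {i, \<pi> i + k}) ` {1..k}" for d
    proof -
      obtain i where i: "i \<in> {1..k}" "d = {i, \<pi> i + k}" using d by blast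
      then have "\<phi> d = e i" using Min[OF i(1)] by (simp only: \<phi>_def)
      moreover have "v ` d = {a i, b (\<pi> i)}" using i rng[OF i(1)] by (auto simp: v_def)
      ultimately show ?thesis using abe(5)[OF i(1)] by simp
    qed
  qed simp
qed

theorem perm_hypergraph_mem_if_superexponential:
  assumes P: "strongly_monotone P" and fast: "\<And>c::real. c > 0 \<Longrightarrow> \<exists>N. real (speed P N) > c ^ N"
    and \<pi>: "\<pi> permutes {1..k}"
  shows "perm_hypergraph k \<pi> \<in> P"
proof (rule ccontr)
  assume out: "perm_hypergraph k \<pi> \<notin> P"
  obtain c :: nat where c: "c > 0" "\<And>n. card (avoiders k \<pi> n) \<le> c ^ n"
    by (rule card_avoiders_exponential[OF \<pi>]) blast
  have "speed P n \<le> c ^ n" for n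
  proof -
    have "std_members P n \<subseteq> avoiders k \<pi> n"
      using perm_hypergraph_mem_if_edges_contain[OF P _ _ _ \<pi>] out
      by (auto simp: std_members_def avoiders_def)
    then have "card (std_members P n) \<le> card (avoiders k \<pi> n)"
      by (intro card_mono finite_avoiders)
    also have "\<dots> \<le> c ^ n" by (rule c(2))
    finally show ?thesis using P by (simp add: strongly_monotone_def speed_eq_card_std_members)
  qed
  then have "real (speed P n) \<le> real c ^ n" for n by (metis of_nat_le_iff of_nat_power)
  then show False using fast[of "real c"] c(1) by (metis leD of_nat_0_less_iff)
qed

section \<open>Separated matchings\<close>

definition separated_matching :: "nat set set \<Rightarrow> bool" where
  "separated_matching E \<longleftrightarrow>
     pairwise disjnt E \<and> (\<exists>a. \<forall>e\<in>E. \<exists>x y. e = {x, y} \<and> x < a \<and> a \<le> y)"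

lemma separated_matchingE:
  assumes "separated_matching E"
  obtains a lo hi where "pairwise disjnt E"
    "\<And>e. e \<in> E \<Longrightarrow> e = {lo e, hi e} \<and> lo e < a \<and> a \<le> hi e" "inj_on lo E" "inj_on hi E"
proof -
  obtain a where disj: "pairwise disjnt E" and "\<forall>e\<in>E. \<exists>x y. e = {x, y} \<and> x < a \<and> a \<le> y"
    using assms unfolding separated_matching_def by blast
  then obtain lo hi where lh: "\<And>e. e \<in> E \<Longrightarrow> e = {lo e, hi e} \<and> lo e < a \<and> a \<le> hi e" by metis
  have "e = e'" if "e \<in> E" "e' \<in> E" "x \<in> e" "x \<in> e'" for e e' x
    using disj that unfolding pairwise_def disjnt_def by blast
  moreover have "lo e \<in> e" "hi e \<in> e" if "e \<in> E" for e using lh[OF that] by blast+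
  ultimately have "inj_on lo E" "inj_on hi E" by (metis inj_onI)+
  with disj lh show thesis by (rule that)
qed

text \<open>\<open>A\<close> is a down-set of the order, and the gap lies at its end. A down-set
  makes sense for any vertex order and survives unchanged when vertices are deleted, whereas a
  threshold vertex could be lost.\<close>

definition separated_property :: "nat ordered_hypergraph set" where
  "separated_property = {H. ordered_hypergraph H \<and> pairwise disjnt (edges H) \<and>
     (\<exists>A. (\<forall>x\<in>A. \<forall>y. (y, x) \<in> ord H \<longrightarrow> y \<in> A) \<and> (\<forall>e\<in>edges H. \<exists>x y. e = {x, y} \<and> x \<in> A \<and> y \<notin> A))}"

lemma separated_propertyI:
  assumes "ordered_hypergraph H" "pairwise disjnt (edges H)" "\<And>x y. \<lbrakk>x \<in> A; (y, x) \<in> ord H\<rbrakk> \<Longrightarrow> y \<in> A"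
    "\<And>e. e \<in> edges H \<Longrightarrow> \<exists>x y. e = {x, y} \<and> x \<in> A \<and> y \<notin> A"
  shows "H \<in> separated_property"
  using assms unfolding separated_property_def by blast

lemma separated_propertyE:
  assumes "H \<in> separated_property"
  obtains A where "ordered_hypergraph H" "pairwise disjnt (edges H)"
    "\<And>x y. \<lbrakk>x \<in> A; (y, x) \<in> ord H\<rbrakk> \<Longrightarrow> y \<in> A"
    "\<And>e. e \<in> edges H \<Longrightarrow> \<exists>x y. e = {x, y} \<and> x \<in> A \<and> y \<notin> A"
proof -
  obtain A where H: "ordered_hypergraph H" "pairwise disjnt (edges H)"
    and A: "\<forall>x\<in>A. \<forall>y. (y, x) \<in> ord H \<longrightarrow> y \<in> A"
      "\<forall>e\<in>edges H. \<exists>x y. e = {x, y} \<and> x \<in> A \<and> y \<notin> A"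
    using assms unfolding separated_property_def by auto
  show thesis by (rule that[OF H A(1)[rule_format] A(2)[rule_format]])
qed

lemma ord_verts:
  assumes "ordered_hypergraph H" "(x, y) \<in> ord H"
  shows "x \<in> verts H" "y \<in> verts H"
  using assms by (auto simp: ordered_hypergraph_def linear_order_on_def partial_order_on_def
      preorder_on_def refl_on_def)

lemma hypergraph_property_separated_property: "hypergraph_property separated_property"
  unfolding hypergraph_property_def
proof (intro conjI ballI allI impI)
  fix H K assume H: "H \<in> separated_property" and HK: "(H, K) \<in> iso_rel"
  obtain A where disj: "pairwise disjnt (edges H)"
    and A: "\<And>x y. \<lbrakk>x \<in> A; (y, x) \<in> ord H\<rbrakk> \<Longrightarrow> y \<in> A"
      "\<And>e. e \<in> edges H \<Longrightarrow> \<exists>x y. e = {x, y} \<and> x \<in> A \<and> y \<notin> A"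
    using H by (rule separated_propertyE) blast
  obtain f where oh: "ordered_hypergraph H" "ordered_hypergraph K"
    and f: "bij_betw f (verts H) (verts K)"
    and o: "\<And>x y. \<lbrakk>x \<in> verts H; y \<in> verts H\<rbrakk> \<Longrightarrow> (x, y) \<in> ord H \<longleftrightarrow> (f x, f y) \<in> ord K"
    and E: "edges K = (`) f ` edges H"
    using HK by (rule iso_relE) blast
  have sub: "e \<subseteq> verts H" if "e \<in> edges H" for e using oh(1) that by (auto simp: ordered_hypergraph_def)
  have inj: "inj_on f (verts H)" using f by (simp add: bij_betw_def)
  show "K \<in> separated_property"
  proof (rule separated_propertyI)
    show "pairwise disjnt (edges K)"
      unfolding E pairwise_image
    proof (rule pairwiseI, rule impI)
      fix d e assume "d \<in> edges H" "e \<in> edges H" "f ` d \<noteq> f ` e"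
      then have "disjnt d e" using disj by (metis pairwiseD)
      then show "disjnt (f ` d) (f ` e)"
        using inj_on_image_Int[OF inj sub[OF \<open>d \<in> edges H\<close>] sub[OF \<open>e \<in> edges H\<close>]]
        by (simp add: disjnt_def)
    qed
    show "y \<in> f ` (A \<inter> verts H)" if x: "x \<in> f ` (A \<inter> verts H)" "(y, x) \<in> ord K" for x y
    proof -
      obtain u where u: "u \<in> A" "u \<in> verts H" "x = f u" using x(1) by blast
      have "y \<in> f ` verts H" using ord_verts(1)[OF oh(2) x(2)] f by (simp add: bij_betw_def)
      then obtain w where w: "w \<in> verts H" "y = f w" by blast
      then show ?thesis using A(1)[of u w] o[of w u] u x(2) by blast
    qed
    show "\<exists>x y. e = {x, y} \<and> x \<in> f ` (A \<inter> verts H) \<and> y \<notin> f ` (A \<inter> verts H)" if e: "e \<in> edges K" for e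
    proof -
      obtain d where d: "d \<in> edges H" "e = f ` d" using e E by blast
      obtain x y where xy: "d = {x, y}" "x \<in> A" "y \<notin> A" using A(2)[OF d(1)] by blast
      then have "x \<in> verts H" "y \<in> verts H" using sub[OF d(1)] by auto
      then have "f x \<in> f ` (A \<inter> verts H)" "f y \<notin> f ` (A \<inter> verts H)"
        using xy inj by (auto dest: inj_onD)
      then show ?thesis using d(2) xy(1) by blast
    qed
  qed (rule oh(2))
qed (auto simp: separated_property_def)

text \<open>Every edge of the contained hypergraph has at least two vertices and lies in a pair that
  is an edge of the larger one, so it equals that pair. Hence edges can only disappear, and the same
  \<open>A\<close> still works.\<close>

lemma strongly_monotone_separated_property: "strongly_monotone separated_property"
  unfolding strongly_monotone_def
proof (intro conjI ballI allI impI hypergraph_property_separated_property)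
  fix H K assume H: "H \<in> separated_property" and KH: "contained_in K H"
  obtain A where disj: "pairwise disjnt (edges H)"
    and A: "\<And>x y. \<lbrakk>x \<in> A; (y, x) \<in> ord H\<rbrakk> \<Longrightarrow> y \<in> A"
      "\<And>e. e \<in> edges H \<Longrightarrow> \<exists>x y. e = {x, y} \<and> x \<in> A \<and> y \<notin> A"
    using H by (rule separated_propertyE) blast
  obtain L t d g where K: "ordered_hypergraph K" and L: "sub_hypergraph L H" "ord L = ord K"
    and d: "bij_betw d {1..t::nat} (edges L)" and g: "bij_betw g {1..t} (edges K)"
    and gd: "\<And>i. i \<in> {1..t} \<Longrightarrow> g i \<subseteq> d i"
    using KH unfolding contained_in_def by blast
  have sub: "edges K \<subseteq> edges H"
  proof
    fix e assume e: "e \<in> edges K"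
    then have "e \<in> g ` {1..t}" using g by (simp add: bij_betw_def)
    then obtain i where i: "i \<in> {1..t}" "e = g i" by blast
    have "d i \<in> edges L" using d i(1) by (rule bij_betw_apply)
    then obtain h where h: "h \<in> edges H" "d i \<subseteq> h" using L(1) by (auto simp: sub_hypergraph_def)
    obtain x y where "h = {x, y}" using A(2)[OF h(1)] by blast
    moreover have "2 \<le> card e" using K e by (auto simp: ordered_hypergraph_def)
    moreover have "e \<subseteq> h" using i gd h(2) by blast
    ultimately have "e = h" by (intro card_seteq) (auto intro: card_2_iff[THEN iffD2] simp: card_insert_if)
    then show "e \<in> edges H" using h(1) by simp
  qed
  have "ord K \<subseteq> ord H" using L by (auto simp: sub_hypergraph_def)
  with K A sub pairwise_mono[OF disj] show "K \<in> separated_property"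
    by (intro separated_propertyI[of K A]) blast+
qed

lemma std_members_separated_property:
  "std_members separated_property n = {E \<in> edge_sets n. separated_matching E}"
proof -
  have "std {..<n} E \<in> separated_property \<longleftrightarrow> separated_matching E" if E: "E \<in> edge_sets n" for E
  proof
    assume "std {..<n} E \<in> separated_property"
    then obtain A where disj: "pairwise disjnt E"
      and A: "\<And>x y. \<lbrakk>x \<in> A; (y, x) \<in> ord (std {..<n} E)\<rbrakk> \<Longrightarrow> y \<in> A"
        "\<And>e. e \<in> E \<Longrightarrow> \<exists>x y. e = {x, y} \<and> x \<in> A \<and> y \<notin> A"
      by (rule separated_propertyE) auto
    \<comment> \<open>The alternative \<open>n \<le> x\<close> guarantees a least element even when
      \<open>A\<close> contains every vertex; the threshold is then \<open>n\<close>.\<close>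
    define a where "a = (LEAST x. x \<notin> A \<or> n \<le> x)"
    have a: "a \<notin> A \<or> n \<le> a" unfolding a_def by (rule LeastI[of _ n]) simp
    have "x < a \<longleftrightarrow> x \<in> A" if "x < n" for x
    proof
      show "x \<in> A" if "x < a" using that not_less_Least[of x "\<lambda>x. x \<notin> A \<or> n \<le> x"] by (simp add: a_def)
      show "x < a" if "x \<in> A"
      proof (rule ccontr)
        assume "\<not> x < a"
        then have "(a, x) \<in> ord (std {..<n} E)" using \<open>x < n\<close> by simp
        with A(1)[OF that] a \<open>x < n\<close> \<open>\<not> x < a\<close> show False by fastforce
      qed
    qed
    moreover have "x < n" if "x \<in> e" "e \<in> E" for x e using E that by (auto simp: edge_sets_def)
    ultimately have "\<exists>x y. e = {x, y} \<and> x < a \<and> a \<le> y" if "e \<in> E" for e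
      using A(2)[OF that] that by (metis insertCI not_less)
    with disj show "separated_matching E" unfolding separated_matching_def by blast
  next
    assume "separated_matching E"
    then obtain a where disj: "pairwise disjnt E"
      and a: "\<And>e. e \<in> E \<Longrightarrow> \<exists>x y. e = {x, y} \<and> x < a \<and> a \<le> y"
      unfolding separated_matching_def by blast
    show "std {..<n} E \<in> separated_property"
    proof (rule separated_propertyI[where A = "{..<a}"])
      show "\<exists>x y. e = {x, y} \<and> x \<in> {..<a} \<and> y \<notin> {..<a}" if "e \<in> edges (std {..<n} E)" for e
        using a[of e] that by (auto simp: not_less)
    qed (use disj ordered_hypergraph_std_edge_sets[OF E] in auto)
  qed
  then show ?thesis by (auto simp: std_members_def)
qed

lemma extend_to_permutation:
  assumes "finite A" "D \<subseteq> A" "inj_on f D" "f ` D \<subseteq> A"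
  obtains \<sigma> where "\<sigma> permutes A" "\<And>x. x \<in> D \<Longrightarrow> \<sigma> x = f x"
proof -
  have "finite D" using assms(1,2) by (rule rev_finite_subset)
  then have "card (A - D) = card (A - f ` D)"
    using assms by (simp add: card_Diff_subset card_image)
  then obtain g where g: "bij_betw g (A - D) (A - f ` D)"
    using assms(1) finite_same_card_bij[of "A - D" "A - f ` D"] by auto
  define \<sigma> where "\<sigma> x = (if x \<in> D then f x else if x \<in> A then g x else x)" for x
  have "bij_betw \<sigma> D (f ` D)"
    using inj_on_imp_bij_betw[OF assms(3)] by (rule bij_betw_cong[THEN iffD1, rotated]) (simp add: \<sigma>_def)
  moreover have "bij_betw \<sigma> (A - D) (A - f ` D)"
    using g by (rule bij_betw_cong[THEN iffD1, rotated]) (simp add: \<sigma>_def)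
  ultimately have "bij_betw \<sigma> (D \<union> (A - D)) (f ` D \<union> (A - f ` D))"
    by (rule bij_betw_combine) blast
  moreover have "D \<union> (A - D) = A" "f ` D \<union> (A - f ` D) = A" using assms by blast+
  ultimately have "bij_betw \<sigma> A A" by simp
  then have "\<sigma> permutes A" by (rule bij_imp_permutes) (use assms(2) in \<open>auto simp: \<sigma>_def\<close>)
  then show thesis by (rule that) (simp add: \<sigma>_def)
qed

text \<open>The vertices left and right of the gap are placed into the two halves of \<open>{1..2 * n}\<close>;
  the isolated ones are matched up arbitrarily.\<close>

lemma separated_matching_mem:
  assumes P: "strongly_monotone P" and perms: "\<And>\<pi>. \<pi> permutes {1..n} \<Longrightarrow> perm_hypergraph n \<pi> \<in> P"
    and E: "E \<in> edge_sets n" "separated_matching E"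
  shows "std {..<n} E \<in> P"
proof -
  obtain a lo hi where disj: "pairwise disjnt E"
    and lh: "\<And>e. e \<in> E \<Longrightarrow> e = {lo e, hi e} \<and> lo e < a \<and> a \<le> hi e"
    and inj: "inj_on lo E" "inj_on hi E"
    using E(2) by (rule separated_matchingE) blast
  have lt: "lo e < n" "hi e < n" if "e \<in> E" for e
    using E(1) that lh[OF that] by (auto simp: edge_sets_def)
  \<comment> \<open>\<open>perm_hypergraph\<close> numbers its vertices from 1, hence the
    \<open>Suc\<close> here and in \<open>f\<close> and \<open>v\<close>.\<close>
  let ?lo = "\<lambda>e. Suc (lo e)"
  have injS: "inj_on ?lo E" using inj(1) by (auto simp: inj_on_def)
  define f where "f i = Suc (hi (inv_into E ?lo i))" for i
  have f: "f (?lo e) = Suc (hi e)" if "e \<in> E" for e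
    using that by (simp add: f_def inv_into_f_f[OF injS])
  have "inj_on f (?lo ` E)"
    using inj(2) by (intro inj_on_imageI) (auto simp: inj_on_def f)
  then obtain \<sigma> where \<sigma>: "\<sigma> permutes {1..n}" "\<And>i. i \<in> ?lo ` E \<Longrightarrow> \<sigma> i = f i"
    using lt f by (elim extend_to_permutation[of "{1..n}" "?lo ` E", rotated 2]) (auto simp: Suc_le_eq)
  \<comment> \<open>Vertex \<open>x\<close> takes place \<open>x + 1\<close> of the left or of the
    right half. With \<open>n\<close> places in each half this works wherever the gap is.\<close>
  define v where "v x = (if x < a then Suc x else Suc x + n)" for x
  have "strict_mono_on {..<n} v" by (auto simp: strict_mono_on_def v_def)
  then have injv: "inj_on v {..<n}" by (rule strict_mono_on_imp_inj_on)
  show ?thesis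
  proof (rule strongly_monotone_embed[OF P perms[OF \<sigma>(1), unfolded perm_hypergraph_std], where v = v and \<phi> = "(`) v"])
    show "strict_mono_on {..<n} v" by fact
    show "v ` {..<n} \<subseteq> {1..2 * n}" by (auto simp: v_def)
    show "e \<subseteq> {..<n} \<and> 2 \<le> card e" if "e \<in> E" for e using E(1) that by (auto simp: edge_sets_def)
    show "inj_on ((`) v) E"
      using inj_on_image_Pow[OF injv] by (rule inj_on_subset) (use E(1) in \<open>auto simp: edge_sets_def\<close>)
    show "v ` e \<in> (\<lambda>i. {i, \<sigma> i + n}) ` {1..n} \<and> v ` e \<subseteq> v ` e" if e: "e \<in> E" for e
    proof (intro conjI image_eqI[of _ _ "?lo e"] subset_refl)
      have "v (lo e) = ?lo e" "v (hi e) = Suc (hi e) + n" using lh[OF e] by (auto simp: v_def)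
      moreover have "v ` e = {v (lo e), v (hi e)}" using lh[OF e] by (metis image_empty image_insert)
      ultimately show "v ` e = {?lo e, \<sigma> (?lo e) + n}" using \<sigma>(2)[of "?lo e"] f e by simp
      show "?lo e \<in> {1..n}" using lt[OF e] by simp
    qed
  qed simp
qed

section \<open>Counting separated matchings\<close>

lemma card_eq_sum_fibers:
  assumes "finite A" "finite B" "f ` A \<subseteq> B"
  shows "card A = (\<Sum>b\<in>B. card {a \<in> A. f a = b})"
  using sum.group[OF assms, of "\<lambda>_. 1::nat"] by simp

text \<open>The edges of \<open>perm_hypergraph k \<pi>\<close> carried along \<open>s\<close>,
  which will list the covered vertices in increasing order.\<close>

definition matching_of :: "(nat \<Rightarrow> nat) \<Rightarrow> nat \<Rightarrow> (nat \<Rightarrow> nat) \<Rightarrow> nat set set" where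
  "matching_of s k \<pi> = (\<lambda>i. {s i, s (\<pi> i + k)}) ` {1..k}"

context
  fixes s :: "nat \<Rightarrow> nat" and k n :: nat
  assumes s: "strict_mono_on {1..2 * k} s" "s ` {1..2 * k} \<subseteq> {..<n}"
begin

lemma s_eq_iff: "\<lbrakk>i \<in> {1..2 * k}; j \<in> {1..2 * k}\<rbrakk> \<Longrightarrow> s i = s j \<longleftrightarrow> i = j"
  using strict_mono_on_imp_inj_on[OF s(1)] by (rule inj_on_eq_iff)

lemma s_less_iff: "\<lbrakk>i \<in> {1..2 * k}; j \<in> {1..2 * k}\<rbrakk> \<Longrightarrow> s i < s j \<longleftrightarrow> i < j"
  using strict_mono_on_less[OF s(1)] by blast

lemma matching_of_range:
  assumes "\<pi> permutes {1..k}" "i \<in> {1..k}"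
  shows "i \<in> {1..2 * k}" "\<pi> i \<in> {1..k}" "\<pi> i + k \<in> {1..2 * k}" "i < \<pi> i + k"
proof -
  show "\<pi> i \<in> {1..k}" using assms by (simp only: permutes_in_image)
  then show "i \<in> {1..2 * k}" "\<pi> i + k \<in> {1..2 * k}" "i < \<pi> i + k" using assms(2) by auto
qed

lemma matching_of_meet:
  assumes \<pi>: "\<pi> permutes {1..k}" and \<pi>': "\<pi>' permutes {1..k}" and ij: "i \<in> {1..k}" "j \<in> {1..k}"
  shows "s i \<noteq> s (\<pi> j + k)" "s i = s j \<longleftrightarrow> i = j" "s (\<pi> i + k) = s (\<pi>' j + k) \<longleftrightarrow> \<pi> i = \<pi>' j"
  using ij matching_of_range[OF \<pi> ij(1)] matching_of_range[OF \<pi> ij(2)] matching_of_range[OF \<pi>' ij(2)]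
  by (auto simp: s_eq_iff simp del: atLeastAtMost_iff; simp)+

lemma matching_of:
  assumes \<pi>: "\<pi> permutes {1..k}"
  shows "matching_of s k \<pi> \<in> edge_sets n" "separated_matching (matching_of s k \<pi>)"
    "card (matching_of s k \<pi>) = k" "\<Union>(matching_of s k \<pi>) = s ` {1..2 * k}"
proof -
  note rng = matching_of_range[OF \<pi>] and meet = matching_of_meet[OF \<pi> \<pi>]
  have pi_eq: "\<pi> i = \<pi> j \<longleftrightarrow> i = j" for i j using permutes_inj[OF \<pi>] by (simp add: inj_eq)
  have edge: "{s i, s (\<pi> i + k)} \<subseteq> {..<n} \<and> 2 \<le> card {s i, s (\<pi> i + k)}" if "i \<in> {1..k}" for i
  proof -
    have "s i < n" "s (\<pi> i + k) < n" using rng(1,3)[OF that] s(2) by blast+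
    then show ?thesis using meet(1)[OF that that] by simp
  qed
  then show "matching_of s k \<pi> \<in> edge_sets n" unfolding edge_sets_def matching_of_def by blast
  have "inj_on (\<lambda>i. {s i, s (\<pi> i + k)}) {1..k}"
    using meet by (intro inj_onI) (metis doubleton_eq_iff)
  then show "card (matching_of s k \<pi>) = k" by (simp add: matching_of_def card_image)
  have "pairwise disjnt (matching_of s k \<pi>)"
    unfolding matching_of_def pairwise_image
  proof (rule pairwiseI, rule impI)
    fix i j assume ij: "i \<in> {1..k}" "j \<in> {1..k}" "i \<noteq> j"
    show "disjnt {s i, s (\<pi> i + k)} {s j, s (\<pi> j + k)}"
      using meet[OF ij(1,2)] meet[OF ij(2,1)] ij(3) by (simp add: disjnt_def pi_eq)
  qed
  \<comment> \<open>The gap lies right after \<open>s k\<close>, the last left endpoint.\<close>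
  moreover have "\<exists>x y. e = {x, y} \<and> x < Suc (s k) \<and> Suc (s k) \<le> y" if e: "e \<in> matching_of s k \<pi>" for e
  proof -
    obtain i where i: "i \<in> {1..k}" "e = {s i, s (\<pi> i + k)}" using e by (auto simp: matching_of_def)
    then have k: "k \<in> {1..2 * k}" by auto
    have "s i < Suc (s k)"
      using s_less_iff[OF k rng(1)[OF i(1)]] i(1) by simp
    moreover have "Suc (s k) \<le> s (\<pi> i + k)"
      using s_less_iff[OF k rng(3)[OF i(1)]] rng(2)[OF i(1)] by simp
    ultimately show ?thesis using i(2) by blast
  qed
  ultimately show "separated_matching (matching_of s k \<pi>)" unfolding separated_matching_def by blast
  have "\<Union>(matching_of s k \<pi>) = s ` ({1..k} \<union> (\<lambda>i. i + k) ` \<pi> ` {1..k})"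
    by (auto simp: matching_of_def)
  also have "\<pi> ` {1..k} = {1..k}" using \<pi> by (rule permutes_image)
  also have "(\<lambda>i. i + k) ` {1..k} = {1 + k..k + k}" by (rule image_add_atLeastAtMost')
  also have "{1..k} \<union> {1 + k..k + k} = {1..2 * k}" by auto
  finally show "\<Union>(matching_of s k \<pi>) = s ` {1..2 * k}" .
qed

lemma inj_on_matching_of: "inj_on (matching_of s k) {\<pi>. \<pi> permutes {1..k}}"
proof (rule inj_onI, rule ext)
  fix \<pi> \<pi>' x assume "\<pi> \<in> {\<pi>. \<pi> permutes {1..k}}" "\<pi>' \<in> {\<pi>. \<pi> permutes {1..k}}"
    and eq: "matching_of s k \<pi> = matching_of s k \<pi>'"
  then have \<pi>: "\<pi> permutes {1..k}" and \<pi>': "\<pi>' permutes {1..k}" by auto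
  show "\<pi> x = \<pi>' x"
  proof (cases "x \<in> {1..k}")
    case True
    then have "{s x, s (\<pi> x + k)} \<in> matching_of s k \<pi>'"
      unfolding eq[symmetric] by (simp add: matching_of_def)
    then obtain j where j: "j \<in> {1..k}" "{s x, s (\<pi> x + k)} = {s j, s (\<pi>' j + k)}"
      by (auto simp: matching_of_def)
    then show ?thesis
      using matching_of_meet[OF \<pi>' \<pi>' True j(1)] matching_of_meet[OF \<pi> \<pi>' True j(1)]
      by (metis doubleton_eq_iff)
  next
    case False
    then show ?thesis using \<pi> \<pi>' by (simp add: permutes_def)
  qed
qed

text \<open>Each of the \<open>k\<close> edges has one endpoint on either side of the gap, so
  exactly \<open>k\<close> of the \<open>2 * k\<close> covered points lie before it. These form an
  initial segment, hence are \<open>s 1, ..., s k\<close>, and their partners define the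
  permutation.\<close>

lemma matching_of_surj:
  assumes E: "separated_matching E" "card E = k" "\<Union>E = s ` {1..2 * k}"
  shows "\<exists>\<pi>. \<pi> permutes {1..k} \<and> E = matching_of s k \<pi>"
proof -
  obtain a lo hi where disj: "pairwise disjnt E"
    and lh: "\<And>e. e \<in> E \<Longrightarrow> e = {lo e, hi e} \<and> lo e < a \<and> a \<le> hi e"
    and inj: "inj_on lo E" "inj_on hi E"
    using E(1) by (rule separated_matchingE) blast
  have mem: "lo e \<in> e" "hi e \<in> e" if "e \<in> E" for e using lh[OF that] by blast+
  define J where "J = {i \<in> {1..2 * k}. s i < a}"
  have "s ` J = lo ` E"
  proof (intro equalityI subsetI)
    fix x assume "x \<in> s ` J"
    then have "x \<in> \<Union>E" "x < a" by (auto simp: J_def E(3))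
    then obtain e where e: "e \<in> E" "x \<in> e" "x < a" by blast
    then have "x = lo e" using lh[OF e(1)] by (metis insertE leD singletonD)
    then show "x \<in> lo ` E" using e(1) by blast
  next
    fix x assume "x \<in> lo ` E"
    then obtain e where e: "e \<in> E" "x = lo e" by blast
    then have "x \<in> s ` {1..2 * k}" using mem E(3) by blast
    then show "x \<in> s ` J" using lh[OF e(1)] e(2) by (auto simp: J_def)
  qed
  moreover have "inj_on s J" by (rule inj_onI) (auto simp: J_def s_eq_iff simp del: atLeastAtMost_iff)
  ultimately have cJ: "card J = k" using E(2) inj(1) by (metis card_image)
  have "J \<subseteq> {1..k}"
  proof
    fix i assume i: "i \<in> J"
    have "{1..i} \<subseteq> J"
    proof
      fix j assume j: "j \<in> {1..i}"
      then have j': "j \<in> {1..2 * k}" using i by (auto simp: J_def)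
      have "\<not> s i < s j" using j s_less_iff[of i j] j' i by (simp add: J_def)
      then show "j \<in> J" using i j' by (auto simp: J_def)
    qed
    then have "i \<le> card J" using card_mono[of J "{1..i}"] by (simp add: J_def)
    then show "i \<in> {1..k}" using i cJ by (simp add: J_def)
  qed
  then have J: "J = {1..k}" using cJ by (intro card_subset_eq) auto
  have low: "s i < a \<longleftrightarrow> i \<le> k" if "i \<in> {1..2 * k}" for i
  proof -
    have "i \<in> J \<longleftrightarrow> s i < a" "i \<in> J \<longleftrightarrow> i \<le> k" using that by (simp add: J_def, simp add: J)
    then show ?thesis by simp
  qed
  have "\<exists>j. k < j \<and> j \<in> {1..2 * k} \<and> {s i, s j} \<in> E" if i: "i \<in> {1..k}" for i
  proof -
    have "s i \<in> \<Union>E" using i E(3) by auto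
    then obtain e where e: "e \<in> E" "s i \<in> e" by blast
    have "s i < a" using i low by simp
    then have si: "s i = lo e" using lh[OF e(1)] e(2) by (metis insertE leD singletonD)
    have "hi e \<in> s ` {1..2 * k}" using mem(2)[OF e(1)] e(1) E(3) by blast
    then obtain j where j: "j \<in> {1..2 * k}" "hi e = s j" by blast
    moreover have "\<not> j \<le> k" using low[OF j(1)] lh[OF e(1)] j(2) by simp
    moreover have "{s i, s j} \<in> E" using e(1) lh[OF e(1)] si j(2) by metis
    ultimately show ?thesis by (metis not_le)
  qed
  then obtain p where p: "\<And>i. i \<in> {1..k} \<Longrightarrow> k < p i \<and> p i \<in> {1..2 * k} \<and> {s i, s (p i)} \<in> E" by metis
  define \<pi> where "\<pi> i = (if i \<in> {1..k} then p i - k else i)" for i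
  have p_eq: "p i = \<pi> i + k" if "i \<in> {1..k}" for i using p[OF that] that by (simp add: \<pi>_def)
  have "\<pi> permutes {1..k}"
  proof (rule bij_imp_permutes)
    have "inj_on \<pi> {1..k}"
    proof (rule inj_onI)
      fix i j assume ij: "i \<in> {1..k}" "j \<in> {1..k}" "\<pi> i = \<pi> j"
      then have "p i = p j" using p_eq by simp
      then have "{s i, s (p i)} \<in> E" "{s j, s (p i)} \<in> E" using p[OF ij(1)] p[OF ij(2)] by simp_all
      then have "{s i, s (p i)} = {s j, s (p i)}"
        using pairwiseD[OF disj] by (metis disjnt_iff insertCI)
      moreover have "s i \<noteq> s (p i)" using p[OF ij(1)] ij(1) s_eq_iff[of i "p i"] by auto
      ultimately have "s i = s j" by (metis doubleton_eq_iff)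
      then show "i = j" using ij(1,2) s_eq_iff[of i j] by simp
    qed
    moreover have "\<pi> ` {1..k} \<subseteq> {1..k}" using p by (fastforce simp: \<pi>_def)
    ultimately show "bij_betw \<pi> {1..k} {1..k}" by (simp add: bij_betw_def endo_inj_surj)
  qed (auto simp: \<pi>_def)
  moreover have "matching_of s k \<pi> = E"
  \<comment> \<open>For \<open>k = 0\<close> the condition \<open>card E = k\<close> would also hold
    for infinite \<open>E\<close>, so emptiness is read off from \<open>\<Union>E\<close>
    instead.\<close>
  proof (cases "k = 0")
    case True
    then show ?thesis using E(3) lh by (auto simp: matching_of_def)
  next
    case False
    then have "finite E" using E(2) by (metis card.infinite)
    moreover have "matching_of s k \<pi> \<subseteq> E"
      unfolding matching_of_def using p p_eq by (metis (no_types, lifting) image_subsetI)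
    ultimately show ?thesis using matching_of(3)[OF \<open>\<pi> permutes {1..k}\<close>] E(2) by (intro card_subset_eq) auto
  qed
  ultimately show ?thesis by blast
qed

lemma card_separated_matchings_on:
  "card {E \<in> edge_sets n. separated_matching E \<and> card E = k \<and> \<Union>E = s ` {1..2 * k}} = fact k"
proof -
  have "{E \<in> edge_sets n. separated_matching E \<and> card E = k \<and> \<Union>E = s ` {1..2 * k}}
      = matching_of s k ` {\<pi>. \<pi> permutes {1..k}}"
  proof (intro equalityI subsetI)
    fix E assume "E \<in> {E \<in> edge_sets n. separated_matching E \<and> card E = k \<and> \<Union>E = s ` {1..2 * k}}"
    then show "E \<in> matching_of s k ` {\<pi>. \<pi> permutes {1..k}}" using matching_of_surj[of E] by auto
  next
    fix E assume "E \<in> matching_of s k ` {\<pi>. \<pi> permutes {1..k}}"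
    then obtain \<pi> where "\<pi> permutes {1..k}" "E = matching_of s k \<pi>" by blast
    then show "E \<in> {E \<in> edge_sets n. separated_matching E \<and> card E = k \<and> \<Union>E = s ` {1..2 * k}}"
      using matching_of[of \<pi>] by simp
  qed
  then show ?thesis using card_image[OF inj_on_matching_of] by (simp add: card_permutations)
qed

end

lemma card_Union_separated_matching:
  assumes "E \<in> edge_sets n" "separated_matching E"
  shows "card (\<Union>E) = 2 * card E"
proof -
  obtain a lo hi where disj: "pairwise disjnt E"
    and lh: "\<And>e. e \<in> E \<Longrightarrow> e = {lo e, hi e} \<and> lo e < a \<and> a \<le> hi e"
    using assms(2) by (rule separated_matchingE) blast
  have "card e = 2" if "e \<in> E" for e using lh[OF that] by (metis card_2_iff leD)
  moreover have "finite e" if "e \<in> E" for e using assms(1) that by (rule finite_edge)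
  ultimately show ?thesis using card_Union_disjoint[OF disj] by simp
qed

text \<open>Matchings are sorted by the number \<open>k\<close> of edges and by the set of
  \<open>2 * k\<close> covered vertices. Although several gaps may fit one matching, the covered set
  determines which of its vertices lie on which side, so only the permutation is left to
  choose.\<close>

lemma card_separated_matchings:
  "card {E \<in> edge_sets n. separated_matching E} = extremal_speed n"
proof -
  let ?M = "{E \<in> edge_sets n. separated_matching E}"
  have fin: "finite ?M" using finite_edge_sets by simp
  have Union_sub: "\<Union>E \<subseteq> {..<n}" if "E \<in> ?M" for E using that by (auto simp: edge_sets_def)
  have "card E \<in> {0..n div 2}" if "E \<in> ?M" for E
    using card_mono[OF _ Union_sub[OF that]] card_Union_separated_matching[of E n] that by simp
  then have "card ?M = (\<Sum>k = 0..n div 2. card {E \<in> ?M. card E = k})"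
    using fin by (intro card_eq_sum_fibers) auto
  also have "\<dots> = (\<Sum>k = 0..n div 2. (n choose (2 * k)) * fact k)"
  proof (rule sum.cong)
    fix k
    let ?S = "{S. S \<subseteq> {..<n} \<and> card S = 2 * k}"
    have "card {E \<in> ?M. card E = k} = (\<Sum>S\<in>?S. card {E \<in> {E \<in> ?M. card E = k}. \<Union>E = S})"
    proof (rule card_eq_sum_fibers)
      show "\<Union> ` {E \<in> ?M. card E = k} \<subseteq> ?S"
        using Union_sub card_Union_separated_matching by auto
      show "finite {E \<in> ?M. card E = k}" using fin by (rule rev_finite_subset) blast
    qed simp
    also have "\<dots> = (\<Sum>S\<in>?S. fact k)"
    proof (rule sum.cong)
      fix S assume S: "S \<in> ?S"
      then have "finite S" by (auto intro: finite_subset)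
      then obtain s where s: "strict_mono_on {1..2 * k} s" "s ` {1..2 * k} = S"
        using S by (elim strict_mono_enumeration) auto
      have "card {E \<in> edge_sets n. separated_matching E \<and> card E = k \<and> \<Union>E = S} = fact k"
        using card_separated_matchings_on[of k s n] s S by simp
      then show "card {E \<in> {E \<in> ?M. card E = k}. \<Union>E = S} = fact k" by (simp add: conj_ac)
    qed simp
    also have "\<dots> = (n choose (2 * k)) * fact k" by (simp add: n_subsets)
    finally show "card {E \<in> ?M. card E = k} = (n choose (2 * k)) * fact k" .
  qed simp
  finally show ?thesis by (simp add: extremal_speed_def)
qed

section \<open>Growth of the extremal speed\<close>

lemma extremal_speed_ge_fact: "fact (n div 2) \<le> extremal_speed n"
proof -
  have "fact (n div 2) \<le> (n choose (2 * (n div 2))) * fact (n div 2)"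
    using zero_less_binomial[of "2 * (n div 2)" n] by (simp add: Suc_le_eq)
  also have "\<dots> \<le> extremal_speed n"
    unfolding extremal_speed_def by (rule member_le_sum) auto
  finally show ?thesis .
qed

text \<open>Bounding all factorials by the largest leaves a sum of binomial coefficients. The factor
  \<open>2 ^ n\<close> it contributes is absorbed by the error term in the exponent.\<close>

lemma extremal_speed_le: "extremal_speed n \<le> 2 ^ n * fact (n div 2)"
proof -
  have "extremal_speed n \<le> (\<Sum>k = 0..n div 2. (n choose (2 * k)) * fact (n div 2))"
    unfolding extremal_speed_def by (intro sum_mono mult_left_mono fact_mono) auto
  also have "\<dots> = (\<Sum>k\<in>(*) 2 ` {0..n div 2}. n choose k) * fact (n div 2)"
    by (subst sum.reindex) (auto simp: inj_on_def sum_distrib_right)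
  also have "(\<Sum>k\<in>(*) 2 ` {0..n div 2}. n choose k) \<le> (\<Sum>k\<le>n. n choose k)"
    by (rule sum_mono2) auto
  also have "(\<Sum>k\<le>n. n choose k) = 2 ^ n" by (rule choose_row_sum)
  finally show ?thesis by simp
qed

text \<open>At even arguments \<open>2 * m\<close> the speed is at least \<open>fact m\<close>,
  which outgrows the \<open>m\<close>-th power of the square of \<open>c\<close> because the terms
  of the exponential series tend to 0.\<close>

lemma extremal_speed_superexponential:
  fixes c :: real
  assumes "c > 0"
  shows "\<exists>N. real (extremal_speed N) > c ^ N"
proof -
  have "(\<lambda>m. inverse (fact m) * (c\<^sup>2) ^ m) \<longlonglongrightarrow> 0"
    by (rule summable_LIMSEQ_zero[OF summable_exp])
  then have "eventually (\<lambda>m. inverse (fact m) * (c\<^sup>2) ^ m < 1) sequentially"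
    by (rule order_tendstoD) simp
  then obtain m where "inverse (fact m) * (c\<^sup>2) ^ m < 1" by (auto simp: eventually_sequentially)
  then have "(c\<^sup>2) ^ m < fact m" by (simp add: field_simps)
  also have "\<dots> \<le> real (extremal_speed (2 * m))"
    using extremal_speed_ge_fact[of "2 * m"] by (metis nonzero_mult_div_cancel_left of_nat_fact of_nat_le_iff zero_neq_numeral)
  finally show ?thesis by (metis power_mult)
qed

text \<open>The lower half of a crude Stirling estimate; the induction step rests on
  \<open>m * ln (1 + 1 / m) \<le> 1\<close>.\<close>

lemma ln_fact_ge: "real m * ln (real m) - real m \<le> ln (fact m)"
proof (induction m)
  case (Suc m)
  show ?case
  proof (cases "m = 0")
    case False
    have "ln (real (Suc m)) - ln (real m) = ln (1 + 1 / real m)"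
      using False ln_div[of "1 + real m" "real m"] by (simp add: add_divide_distrib add.commute)
    also have "\<dots> \<le> 1 / real m" by (rule ln_add_one_self_le_self) simp
    finally have "real m * (ln (real (Suc m)) - ln (real m)) \<le> 1" using False by (simp add: field_simps)
    moreover have "ln (fact (Suc m)) = ln (real (Suc m)) + ln (fact m :: real)"
      unfolding fact_Suc by (simp add: ln_mult del: of_nat_Suc)
    ultimately show ?thesis using Suc.IH by (simp add: algebra_simps)
  qed simp
qed simp

lemma ln_fact_le: "ln (fact m) \<le> real m * ln (real m)"
proof (cases "m = 0")
  case False
  have "fact m \<le> real m ^ m" using fact_le_power[of m, where 'a = real] by simp
  then have "ln (fact m) \<le> ln (real m ^ m)" using False by (subst ln_le_cancel_iff) auto
  then show ?thesis using False by (simp add: ln_realpow)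
qed simp

lemma extremal_speed_asymptotics:
  "\<exists>\<epsilon> :: nat \<Rightarrow> real. \<epsilon> \<in> o(\<lambda>n. real n) \<and>
     (\<forall>n\<ge>1. real (extremal_speed n) = real n powr (real n / 2 + \<epsilon> n))"
proof -
  \<comment> \<open>\<open>\<epsilon>\<close> is obtained by solving the equation for the exponent,
    so only its growth is at stake. At \<open>n = 1\<close>, where \<open>ln n\<close> is 0, the
    equation holds because both sides are 1.\<close>
  define \<epsilon> where "\<epsilon> n = ln (real (extremal_speed n)) / ln (real n) - real n / 2" for n
  have pos: "real (extremal_speed n) > 0" for n
    using extremal_speed_ge_fact[of n] fact_gt_zero[of "n div 2", where 'a = nat] by linarith
  have eq: "real (extremal_speed n) = real n powr (real n / 2 + \<epsilon> n)" if "n \<ge> 1" for n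
  proof (cases "n = 1")
    case True
    then show ?thesis by (simp add: extremal_speed_def)
  next
    case False
    then have "ln (real n) > 0" using that by simp
    then show ?thesis using that pos[of n] by (simp add: \<epsilon>_def powr_def)
  qed
  \<comment> \<open>After multiplication by \<open>ln n\<close>, the term 1/2 pays for rounding
    \<open>n / 2\<close> down. The linear term covers \<open>2 ^ n\<close>, the linear loss in the
    estimate of the factorial, and the constant lost when \<open>ln (n div 2)\<close> is replaced by
    \<open>ln n\<close>.\<close>
  have bound: "\<bar>\<epsilon> n\<bar> \<le> 1 / 2 + 2 * (real n / ln (real n))" if n: "n \<ge> 3" for n
  proof -
    define m where "m = n div 2"
    have L: "ln (real n) > 0" using n by simp
    have m: "real m \<le> real n / 2" "real n / 2 - 1 / 2 \<le> real m" "real n / 3 \<le> real m" "m \<ge> 1"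
      using n by (auto simp: m_def)
    have "ln (real (extremal_speed n)) \<le> ln (2 ^ n * fact m)"
      using extremal_speed_le[of n] pos[of n] by (subst ln_le_cancel_iff) (auto simp: m_def simp flip: of_nat_le_iff[where 'a = real])
    also have "\<dots> = real n * ln 2 + ln (fact m)" by (simp add: ln_mult ln_realpow)
    also have "\<dots> \<le> real n * 1 + real m * ln (real m)"
      using ln_fact_le[of m] ln_le_minus_one[of 2] by (intro add_mono mult_left_mono) auto
    also have "real m * ln (real m) \<le> real n / 2 * ln (real n)"
      using m by (intro mult_mono) auto
    finally have upper: "ln (real (extremal_speed n)) \<le> real n + real n / 2 * ln (real n)" by simp
    have ln3: "ln (3::real) \<le> 2" using ln_le_minus_one[of 3] by simp
    have "(real n / 2 - 1 / 2) * (ln (real n) - 2) - real n / 2 \<le> real m * ln (real m) - real m"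
    proof -
      have "ln (real n) - 2 \<le> ln (real n / 3)" using n ln3 by (simp add: ln_div)
      also have "\<dots> \<le> ln (real m)" using m n by (subst ln_le_cancel_iff) auto
      finally have "(real n / 2 - 1 / 2) * (ln (real n) - 2) \<le> (real n / 2 - 1 / 2) * ln (real m)"
        using n by (intro mult_left_mono) auto
      also have "\<dots> \<le> real m * ln (real m)" using m by (intro mult_right_mono) auto
      finally show ?thesis using m(1) by linarith
    qed
    also have "\<dots> \<le> ln (fact m)" by (rule ln_fact_ge)
    also have "\<dots> \<le> ln (real (extremal_speed n))"
      using extremal_speed_ge_fact[of n] pos[of n] by (subst ln_le_cancel_iff) (auto simp: m_def simp flip: of_nat_le_iff[where 'a = real])
    finally have lower: "(real n / 2 - 1 / 2) * (ln (real n) - 2) - real n / 2 \<le> ln (real (extremal_speed n))" .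
    have "\<epsilon> n * ln (real n) = ln (real (extremal_speed n)) - real n / 2 * ln (real n)"
      using L by (simp add: \<epsilon>_def field_simps)
    moreover have "(real n / 2 - 1 / 2) * (ln (real n) - 2) - real n / 2
        = real n / 2 * ln (real n) - 1 / 2 * ln (real n) - 3 / 2 * real n + 1"
      by (simp add: algebra_simps)
    ultimately have "\<bar>\<epsilon> n * ln (real n)\<bar> \<le> 1 / 2 * ln (real n) + 2 * real n"
      using upper lower L by linarith
    then show ?thesis using L by (simp add: abs_mult field_simps)
  qed
  have "\<epsilon> \<in> O(\<lambda>n. 1 / 2 + 2 * (real n / ln (real n)))"
  proof (rule bigoI[of _ 1])
    show "eventually (\<lambda>n. norm (\<epsilon> n) \<le> 1 * norm (1 / 2 + 2 * (real n / ln (real n)))) at_top"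
      using eventually_ge_at_top[of 3]
    proof eventually_elim
      case (elim n)
      then show ?case using bound[OF elim] by simp
    qed
  qed
  also have "(\<lambda>n. 1 / 2 + 2 * (real n / ln (real n))) \<in> o(\<lambda>n. real n)" by real_asymp
  finally have "\<epsilon> \<in> o(\<lambda>n. real n)" .
  with eq show ?thesis by blast
qed

text \<open>That the bound is best possible is expressed by a property that satisfies the growth
  hypothesis and attains the bound for every \<open>n\<close>. The asymptotic clause starts at
  \<open>n = 1\<close> because \<open>0 powr x\<close> is 0, whereas \<open>extremal_speed 0\<close>
  is 1.\<close>

theorem theorem1:
  shows
    "(\<forall>P. strongly_monotone P \<longrightarrow>
        (\<forall>c::real. c > 0 \<longrightarrow> (\<exists>N. real (speed P N) > c ^ N)) \<longrightarrow>
          (\<forall>k \<pi>. \<pi> permutes {1..k} \<longrightarrow> perm_hypergraph k \<pi> \<in> P) \<and>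
          (\<forall>n. speed P n \<ge> speed (bounded_part P 1 2) n \<and>
               speed (bounded_part P 1 2) n \<ge> extremal_speed n)) \<and>
     (\<exists>\<epsilon> :: nat \<Rightarrow> real. \<epsilon> \<in> o(\<lambda>n. real n) \<and>
        (\<forall>n\<ge>1. real (extremal_speed n) = real n powr (real n / 2 + \<epsilon> n))) \<and>
     (\<exists>P. strongly_monotone P \<and>
        (\<forall>c::real. c > 0 \<longrightarrow> (\<exists>N. real (speed P N) > c ^ N)) \<and>
        (\<forall>n. speed P n = extremal_speed n)) \<and>
     (\<exists>!Q. strongly_monotone Q \<and> (\<forall>n. speed Q n = extremal_speed n))"
proof -
  let ?M = "\<lambda>n. {E \<in> edge_sets n. separated_matching E}"
  have members: "?M n \<subseteq> std_members P n"
    if "strongly_monotone P" "\<forall>c::real. c > 0 \<longrightarrow> (\<exists>N. real (speed P N) > c ^ N)" for P n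
    using separated_matching_mem[OF that(1) perm_hypergraph_mem_if_superexponential[OF that(1)]] that(2)
    by (auto simp: std_members_def)
  have wf: "ordered_hypergraph H" if "strongly_monotone P" "H \<in> P" for P H
    using that unfolding strongly_monotone_def hypergraph_property_def by blast
  have bounded: "extremal_speed n \<le> speed (bounded_part P 1 2) n"
    if P: "strongly_monotone P" "\<forall>c::real. c > 0 \<longrightarrow> (\<exists>N. real (speed P N) > c ^ N)" for P n
  proof -
    have "std {..<n} E \<in> bounded_part P 1 2" if E: "E \<in> ?M n" for E
    proof -
      obtain a lo hi where disj: "pairwise disjnt E"
        and lh: "\<And>e. e \<in> E \<Longrightarrow> e = {lo e, hi e} \<and> lo e < a \<and> a \<le> hi e"
        using E separated_matchingE[of E thesis] by blast
      have deg: "card {e \<in> E. v \<in> e} \<le> 1" for v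
      proof -
        have "finite {e \<in> E. v \<in> e}" using E finite_edge_set by auto
        moreover have "e = e'" if "e \<in> E" "v \<in> e" "e' \<in> E" "v \<in> e'" for e e'
          using disj that unfolding pairwise_def disjnt_def by blast
        ultimately show ?thesis by (simp add: card_le_Suc0_iff_eq)
      qed
      have sz: "card e \<le> 2" if "e \<in> E" for e using lh[OF that] by (metis card_2_iff leD order_refl)
      have "std {..<n} E \<in> P" using members[OF P] E by (auto simp: std_members_def)
      with deg sz show ?thesis by (auto simp: bounded_part_def one_enat_def numeral_eq_enat)
    qed
    then have "?M n \<subseteq> std_members (bounded_part P 1 2) n" by (auto simp: std_members_def)
    then have "extremal_speed n \<le> card (std_members (bounded_part P 1 2) n)"
      unfolding card_separated_matchings[symmetric] by (rule card_mono[OF finite_std_members])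
    also have "\<dots> \<le> speed (bounded_part P 1 2) n"
      using wf[OF P(1)] by (intro card_std_members_le_speed) (auto simp: bounded_part_def)
    finally show ?thesis .
  qed
  have speed_bounded: "speed (bounded_part P 1 2) n \<le> speed P n" if "strongly_monotone P" for P n
    using wf[OF that] by (intro speed_mono) (auto simp: bounded_part_def)
  have speed_sep: "speed separated_property n = extremal_speed n" for n
    by (simp add: speed_eq_card_std_members hypergraph_property_separated_property
        std_members_separated_property card_separated_matchings)
  have unique: "Q = separated_property" if Q: "strongly_monotone Q" "\<forall>n. speed Q n = extremal_speed n" for Q
  proof -
    have closed: "hypergraph_property Q" using Q(1) by (simp add: strongly_monotone_def)
    have "\<forall>c::real. c > 0 \<longrightarrow> (\<exists>N. real (speed Q N) > c ^ N)"
      using Q(2) extremal_speed_superexponential by simp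
    from members[OF Q(1) this] have "?M n = std_members Q n" for n
      using Q(2) by (intro card_subset_eq finite_std_members)
        (simp_all add: card_separated_matchings flip: speed_eq_card_std_members[OF closed])
    then have "std_members Q n = std_members separated_property n" for n
      by (simp add: std_members_separated_property)
    then show ?thesis
      using closed hypergraph_property_separated_property
      by (intro equalityI property_subset_if_std_members_subset) auto
  qed
  show ?thesis
  proof (intro conjI)
    show "\<forall>P. strongly_monotone P \<longrightarrow>
        (\<forall>c::real. c > 0 \<longrightarrow> (\<exists>N. real (speed P N) > c ^ N)) \<longrightarrow>
          (\<forall>k \<pi>. \<pi> permutes {1..k} \<longrightarrow> perm_hypergraph k \<pi> \<in> P) \<and>
          (\<forall>n. speed P n \<ge> speed (bounded_part P 1 2) n \<and>
               speed (bounded_part P 1 2) n \<ge> extremal_speed n)"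
      using perm_hypergraph_mem_if_superexponential speed_bounded bounded by blast
    show "\<exists>P. strongly_monotone P \<and>
        (\<forall>c::real. c > 0 \<longrightarrow> (\<exists>N. real (speed P N) > c ^ N)) \<and>
        (\<forall>n. speed P n = extremal_speed n)"
      using strongly_monotone_separated_property speed_sep extremal_speed_superexponential
      by (intro exI[of _ separated_property]) simp
    show "\<exists>!Q. strongly_monotone Q \<and> (\<forall>n. speed Q n = extremal_speed n)"
      using strongly_monotone_separated_property speed_sep unique by (intro ex1I[of _ separated_property]) auto
  qed (rule extremal_speed_asymptotics)
qed

end
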